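(* Let $\Omega$ be an open subset of $\mathbb{C}$ and let $Y$ be a complex strictly convex (complex) Banach space whose dual $Y^*$ is also complex strictly convex. Let $\psi \in \Psi$ and let $\mathcal{Y} := Y \oplus_\psi \mathbb{C}$, with its $\psi$-dependent norm $\|\cdot\|$. Suppose $A : \mathcal{Y} \to \mathcal{Y}$ is a closed densely defined linear operator with a compact resolvent $(A - \lambda I)^{-1}$ defined for all $\lambda \in \Omega$, and let $M$ be a real number. If $\|(A-\lambda I)^{-1}\| \le M$ for all $\lambda \in \Omega$, then $\|(A-\lambda I)^{-1}\| < M$ for all $\lambda \in \Omega$.
   Context: A complex Banach space $Y$ is called complex strictly convex if the following holds: whenever $x, y \in Y$, $\|x\| = 1$ and $\|x + \zeta y\| \le 1$ for all $\zeta \in \mathbb{C}$ with $|\zeta| \le 1$, then $y = 0$. $\Psi$ denotes the set of all continuous, convex functions $\psi : [0,1] \to \mathbb{R}$ such that $\psi(0) = \psi(1) = 1$ and $\max\{1-t, t\} \le \psi(t) \le 1$ for $0 \le t \le 1$. For $\psi \in \Psi$, a norm on $\mathbb{C}^2$ is defined by $$\|(z, v)\|_\psi = (|z| + |v|)\, \psi\!\left(\frac{|v|}{|z|+|v|}\right) \text{ if } (z,v) \ne (0,0), \qquad \|(0,0)\|_\psi = 0.$$ For Banach spaces $X, Y$, the $\psi$-direct sum $X \oplus_\psi Y$ is the algebraic direct sum $X \oplus Y$ with the norm $\|(x,y)\| = \big\|(\|x\|_X, \|y\|_Y)\big\|_\psi$. A closed densely defined operator $A : \mathcal{Y} \to \mathcal{Y}$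 means a (possibly unbounded) closed linear operator with dense domain in $\mathcal{Y}$ and values in $\mathcal{Y}$. That its compact resolvent is defined for all $\lambda \in \Omega$ means that $\Omega$ is contained in the resolvent set of $A$ and $(A-\lambda I)^{-1}$ is a compact operator on $\mathcal{Y}$ for $\lambda$ in the resolvent set. *)

theory Defs
  imports "HOL-Analysis.Analysis"
begin

section \<open>Complex Banach spaces\<close>

class complex_vector = real_vector +
  fixes scaleC :: "complex \<Rightarrow> 'a \<Rightarrow> 'a"  (infixr \<open>*\<^sub>C\<close> 75)
  assumes scaleC_add_right: "c *\<^sub>C (x + y) = c *\<^sub>C x + c *\<^sub>C y"
    and scaleC_add_left: "(c + d) *\<^sub>C x = c *\<^sub>C x + d *\<^sub>C x"
    and scaleC_scaleC: "c *\<^sub>C d *\<^sub>C x = (c * d) *\<^sub>C x"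
    and scaleC_of_real: "complex_of_real r *\<^sub>C x = r *\<^sub>R x"

class complex_normed_vector = complex_vector + real_normed_vector +
  assumes norm_scaleC: "norm (c *\<^sub>C x) = cmod c * norm x"

class complex_banach = complex_normed_vector + complete_space

subclass (in complex_banach) banach ..

lemma scaleC_one [simp]: "1 *\<^sub>C x = (x :: 'a :: complex_vector)"
  using scaleC_of_real[of 1 x] by simp

instantiation complex :: complex_banach
begin

definition scaleC_complex :: "complex \<Rightarrow> complex \<Rightarrow> complex"
  where "scaleC_complex c z = c * z"

instance
  by standard (auto simp: scaleC_complex_def algebra_simps norm_mult scaleR_conv_of_real)

end

text \<open>Only the algebraic structure of the direct sum is taken from the product type. Its library
  norm is the Euclidean combination of the two norms, which is not used below.\<close>

instantiation prod :: (complex_vector, complex_vector) complex_vector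
begin

definition scaleC_prod :: "complex \<Rightarrow> 'a \<times> 'b \<Rightarrow> 'a \<times> 'b"
  where "scaleC_prod c p = (c *\<^sub>C fst p, c *\<^sub>C snd p)"

instance
  by standard
    (auto simp: scaleC_prod_def scaleC_add_right scaleC_add_left scaleC_scaleC scaleC_of_real
        scaleR_prod_def)

end

definition csubspace :: "'a::complex_vector set \<Rightarrow> bool"
  where "csubspace D \<longleftrightarrow> 0 \<in> D \<and> (\<forall>x\<in>D. \<forall>y\<in>D. x + y \<in> D) \<and> (\<forall>c. \<forall>x\<in>D. c *\<^sub>C x \<in> D)"

definition clinear_on :: "'a::complex_vector set \<Rightarrow> ('a \<Rightarrow> 'b::complex_vector) \<Rightarrow> bool"
  where "clinear_on D f \<longleftrightarrow> csubspace D \<and> (\<forall>x\<in>D. \<forall>y\<in>D. f (x + y) = f x + f y) \<and>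
    (\<forall>c. \<forall>x\<in>D. f (c *\<^sub>C x) = c *\<^sub>C f x)"


section \<open>The dual space\<close>

text \<open>The complex-linear elements of the real Banach space of bounded real-linear maps into the
  complex numbers, with its operator norm.\<close>

typedef (overloaded) 'a cdual =
  "{f :: 'a::complex_normed_vector \<Rightarrow>\<^sub>L complex.
      \<forall>c x. blinfun_apply f (c *\<^sub>C x) = c * blinfun_apply f x}"
  by (rule exI[of _ 0]) auto

lemma Rep_cdual_scaleC: "blinfun_apply (Rep_cdual f) (c *\<^sub>C x) = c * blinfun_apply (Rep_cdual f) x"
  using Rep_cdual[of f] by auto

lemma blinfun_apply_Blinfun_mult:
  "blinfun_apply (Blinfun (\<lambda>x. c * blinfun_apply (f :: 'a::real_normed_vector \<Rightarrow>\<^sub>L complex) x)) x =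
    c * blinfun_apply f x"
  by (subst bounded_linear_Blinfun_apply)
    (auto intro!: bounded_linear_const_mult blinfun.bounded_linear_right)

instantiation cdual :: (complex_normed_vector) complex_normed_vector
begin

definition zero_cdual :: "'a cdual" where "zero_cdual = Abs_cdual 0"
definition plus_cdual :: "'a cdual \<Rightarrow> 'a cdual \<Rightarrow> 'a cdual"
  where "plus_cdual f g = Abs_cdual (Rep_cdual f + Rep_cdual g)"
definition minus_cdual :: "'a cdual \<Rightarrow> 'a cdual \<Rightarrow> 'a cdual"
  where "minus_cdual f g = Abs_cdual (Rep_cdual f - Rep_cdual g)"
definition uminus_cdual :: "'a cdual \<Rightarrow> 'a cdual"
  where "uminus_cdual f = Abs_cdual (- Rep_cdual f)"
definition scaleR_cdual :: "real \<Rightarrow> 'a cdual \<Rightarrow> 'a cdual"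
  where "scaleR_cdual r f = Abs_cdual (r *\<^sub>R Rep_cdual f)"
definition scaleC_cdual :: "complex \<Rightarrow> 'a cdual \<Rightarrow> 'a cdual"
  where "scaleC_cdual c f = Abs_cdual (Blinfun (\<lambda>x. c * blinfun_apply (Rep_cdual f) x))"
definition norm_cdual :: "'a cdual \<Rightarrow> real" where "norm_cdual f = norm (Rep_cdual f)"
definition dist_cdual :: "'a cdual \<Rightarrow> 'a cdual \<Rightarrow> real" where "dist_cdual f g = norm (f - g)"
definition sgn_cdual :: "'a cdual \<Rightarrow> 'a cdual" where "sgn_cdual f = inverse (norm f) *\<^sub>R f"
definition uniformity_cdual :: "('a cdual \<times> 'a cdual) filter"
  where "uniformity_cdual = (INF e\<in>{0 <..}. principal {(x, y). dist x y < e})"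
definition open_cdual :: "'a cdual set \<Rightarrow> bool"
  where "open_cdual S = (\<forall>x\<in>S. \<forall>\<^sub>F (x', y) in uniformity. x' = x \<longrightarrow> y \<in> S)"

lemma Rep_cdual_simps:
  "Rep_cdual (0 :: 'a cdual) = 0"
  "Rep_cdual (f + g :: 'a cdual) = Rep_cdual f + Rep_cdual g"
  "Rep_cdual (f - g :: 'a cdual) = Rep_cdual f - Rep_cdual g"
  "Rep_cdual (- f :: 'a cdual) = - Rep_cdual f"
  "Rep_cdual (r *\<^sub>R f :: 'a cdual) = r *\<^sub>R Rep_cdual f"
  "blinfun_apply (Rep_cdual (c *\<^sub>C f :: 'a cdual)) x = c * blinfun_apply (Rep_cdual f) x"
  by (simp_all add: zero_cdual_def plus_cdual_def minus_cdual_def uminus_cdual_def scaleR_cdual_def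
      scaleC_cdual_def Abs_cdual_inverse blinfun_apply_Blinfun_mult blinfun.bilinear_simps
      Rep_cdual_scaleC algebra_simps)

instance
proof
  fix f g h :: "'a cdual" and r s :: real and c d :: complex
  have eqI: "f = g" if "\<And>x. blinfun_apply (Rep_cdual f) x = blinfun_apply (Rep_cdual g) x"
    for f g :: "'a cdual"
    using that by (metis Rep_cdual_inject blinfun_eqI)
  show "f + g + h = f + (g + h)" "f + g = g + f" "0 + f = f" "- f + f = 0" "f - g = f + - g"
    "r *\<^sub>R (f + g) = r *\<^sub>R f + r *\<^sub>R g" "(r + s) *\<^sub>R f = r *\<^sub>R f + s *\<^sub>R f"
    "r *\<^sub>R s *\<^sub>R f = (r * s) *\<^sub>R f" "1 *\<^sub>R f = f"
    "c *\<^sub>C (f + g) = c *\<^sub>C f + c *\<^sub>C g" "(c + d) *\<^sub>C f = c *\<^sub>C f + d *\<^sub>C f"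
    "c *\<^sub>C d *\<^sub>C f = (c * d) *\<^sub>C f" "complex_of_real r *\<^sub>C f = r *\<^sub>R f"
    by (rule eqI; simp add: Rep_cdual_simps blinfun.bilinear_simps algebra_simps
        scaleR_conv_of_real)+
  show "dist f g = norm (f - g)" by (fact dist_cdual_def)
  show "sgn f = inverse (norm f) *\<^sub>R f" by (fact sgn_cdual_def)
  show "uniformity = (INF e\<in>{0 <..}. principal {(x, y :: 'a cdual). dist x y < e})"
    by (fact uniformity_cdual_def)
  show "open S = (\<forall>x\<in>S. \<forall>\<^sub>F (x', y) in uniformity. x' = x \<longrightarrow> y \<in> S)" for S :: "'a cdual set"
    by (fact open_cdual_def)
  show "norm f = 0 \<longleftrightarrow> f = 0"
    by (metis Rep_cdual_inject Rep_cdual_simps(1) norm_cdual_def norm_eq_zero)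
  show "norm (f + g) \<le> norm f + norm g"
    by (simp add: norm_cdual_def Rep_cdual_simps norm_triangle_ineq)
  show "norm (r *\<^sub>R f) = \<bar>r\<bar> * norm f"
    by (simp add: norm_cdual_def Rep_cdual_simps)
  show "norm (c *\<^sub>C f) = cmod c * norm f"
  proof -
    have le: "norm (c *\<^sub>C f) \<le> cmod c * norm f" for c and f :: "'a cdual"
      unfolding norm_cdual_def
      by (rule norm_blinfun_bound)
        (auto simp: Rep_cdual_simps norm_mult mult.assoc intro!: mult_left_mono norm_blinfun)
    show ?thesis
    proof (cases "c = 0")
      case True
      then show ?thesis using le[of 0 f] by (simp add: norm_cdual_def order_antisym)
    next
      case False
      have "inverse c *\<^sub>C c *\<^sub>C f = f"
        by (rule eqI) (simp add: Rep_cdual_simps False)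
      then have "norm f \<le> cmod (inverse c) * norm (c *\<^sub>C f)"
        using le[of "inverse c" "c *\<^sub>C f"] by simp
      then have "cmod c * norm f \<le> norm (c *\<^sub>C f)"
        using False by (simp add: norm_divide field_simps)
      with le[of c f] show ?thesis by simp
    qed
  qed
qed

end

lemma norm_cdual_eq_onorm: "norm f = onorm (blinfun_apply (Rep_cdual f))"
  by (simp add: norm_cdual_def norm_blinfun.rep_eq)

instance cdual :: (complex_normed_vector) complex_banach
proof
  fix X :: "nat \<Rightarrow> 'a cdual"
  have dist: "dist (Rep_cdual f) (Rep_cdual g) = dist f g" for f g :: "'a cdual"
    by (simp add: dist_norm norm_cdual_def Rep_cdual_simps)
  assume "Cauchy X"
  then have "Cauchy (\<lambda>n. Rep_cdual (X n))"
    by (simp add: Cauchy_def dist)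
  then obtain L where L: "(\<lambda>n. Rep_cdual (X n)) \<longlonglongrightarrow> L"
    using Cauchy_convergent convergent_def by blast
  have "blinfun_apply L (c *\<^sub>C x) = c * blinfun_apply L x" for c x
  proof (rule LIMSEQ_unique)
    show "(\<lambda>n. blinfun_apply (Rep_cdual (X n)) (c *\<^sub>C x)) \<longlonglongrightarrow> blinfun_apply L (c *\<^sub>C x)"
      by (intro blinfun.tendsto L tendsto_const)
    show "(\<lambda>n. blinfun_apply (Rep_cdual (X n)) (c *\<^sub>C x)) \<longlonglongrightarrow> c * blinfun_apply L x"
      unfolding Rep_cdual_scaleC by (intro tendsto_intros L)
  qed
  then have "Rep_cdual (Abs_cdual L) = L"
    by (simp add: Abs_cdual_inverse)
  then have "X \<longlonglongrightarrow> Abs_cdual L"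
    using L by (simp add: tendsto_dist_iff[of _ L] tendsto_dist_iff[of X] flip: dist)
  then show "convergent X"
    by (auto simp: convergent_def)
qed


section \<open>Complex strict convexity\<close>

definition complex_strictly_convex :: "'a::complex_normed_vector itself \<Rightarrow> bool"
  where "complex_strictly_convex (TYPE('a)) \<longleftrightarrow>
    (\<forall>x y :: 'a. norm x = 1 \<and> (\<forall>\<zeta>::complex. cmod \<zeta> \<le> 1 \<longrightarrow> norm (x + \<zeta> *\<^sub>C y) \<le> 1) \<longrightarrow> y = 0)"


section \<open>The direct sum norm\<close>

definition Psi :: "(real \<Rightarrow> real) set"
  where "Psi = {\<psi>. continuous_on {0..1} \<psi> \<and> convex_on {0..1} \<psi> \<and> \<psi> 0 = 1 \<and> \<psi> 1 = 1 \<and>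
    (\<forall>t\<in>{0..1}. max (1 - t) t \<le> \<psi> t \<and> \<psi> t \<le> 1)}"

definition psi_norm :: "(real \<Rightarrow> real) \<Rightarrow> complex \<times> complex \<Rightarrow> real"
  where "psi_norm \<psi> = (\<lambda>(z, v).
    if (z, v) = (0, 0) then 0 else (cmod z + cmod v) * \<psi> (cmod v / (cmod z + cmod v)))"

definition psi_sum_norm ::
    "(real \<Rightarrow> real) \<Rightarrow> 'a::real_normed_vector \<times> 'b::real_normed_vector \<Rightarrow> real"
  where "psi_sum_norm \<psi> = (\<lambda>(x, y). psi_norm \<psi> (complex_of_real (norm x), complex_of_real (norm y)))"


section \<open>Unbounded operators\<close>

text \<open>The norm \<open>N\<close> is an explicit parameter, since the norm of the direct sum depends on a function
  and therefore cannot come from a type class instance. An operator is given by its domain \<open>D\<close> and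
  a map \<open>A\<close> whose values outside \<open>D\<close> are irrelevant.\<close>

definition norm_topology :: "('v::complex_vector \<Rightarrow> real) \<Rightarrow> 'v topology"
  where "norm_topology N = Metric_space.mtopology UNIV (\<lambda>x y. N (x - y))"

definition densely_defined :: "('v::complex_vector \<Rightarrow> real) \<Rightarrow> 'v set \<Rightarrow> bool"
  where "densely_defined N D \<longleftrightarrow> norm_topology N closure_of D = UNIV"

definition closed_operator ::
    "('v::complex_vector \<Rightarrow> real) \<Rightarrow> 'v set \<Rightarrow> ('v \<Rightarrow> 'v) \<Rightarrow> bool"
  where "closed_operator N D A \<longleftrightarrow>
    closedin (prod_topology (norm_topology N) (norm_topology N)) {(x, A x) | x. x \<in> D}"

definition resolvent :: "'v::complex_vector set \<Rightarrow> ('v \<Rightarrow> 'v) \<Rightarrow> complex \<Rightarrow> 'v \<Rightarrow> 'v"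
  where "resolvent D A \<mu> = inv_into D (\<lambda>x. A x - \<mu> *\<^sub>C x)"

definition resolvent_set ::
    "('v::complex_vector \<Rightarrow> real) \<Rightarrow> 'v set \<Rightarrow> ('v \<Rightarrow> 'v) \<Rightarrow> complex set"
  where "resolvent_set N D A = {\<mu>. bij_betw (\<lambda>x. A x - \<mu> *\<^sub>C x) D UNIV \<and>
    (\<exists>C. \<forall>y. N (resolvent D A \<mu> y) \<le> C * N y)}"

definition compact_operator :: "('v::complex_vector \<Rightarrow> real) \<Rightarrow> ('v \<Rightarrow> 'v) \<Rightarrow> bool"
  where "compact_operator N f \<longleftrightarrow> clinear_on UNIV f \<and>
    compactin (norm_topology N) (norm_topology N closure_of (f ` {x. N x \<le> 1}))"

text \<open>As in \<^const>\<open>onorm\<close>, the quotient is \<open>0\<close> at \<open>x = 0\<close>, and the supremum is only meaningful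
  for bounded \<open>f\<close>.\<close>

definition op_norm :: "('v::complex_vector \<Rightarrow> real) \<Rightarrow> ('v \<Rightarrow> 'v) \<Rightarrow> real"
  where "op_norm N f = (SUP x. N (f x) / N x)"


section \<open>The direct sum norm is a norm\<close>

lemma psi_sum_norm_alt:
  "psi_sum_norm \<psi> p =
    (norm (fst p) + norm (snd p)) * \<psi> (norm (snd p) / (norm (fst p) + norm (snd p)))"
  by (auto simp: psi_sum_norm_def psi_norm_def split: prod.splits)

context
  fixes \<psi> :: "real \<Rightarrow> real"
  assumes psi: "\<psi> \<in> Psi"
begin

private definition F :: "real \<Rightarrow> real \<Rightarrow> real"
  where "F a b = (a + b) * \<psi> (b / (a + b))"

private lemma F_ge: assumes "0 \<le> a" "0 \<le> b" shows "a \<le> F a b" "b \<le> F a b"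
proof -
  show "a \<le> F a b"
  proof (cases "a + b = 0")
    case True then show ?thesis using assms by (simp add: F_def)
  next
    case False
    then have pos: "a + b > 0" using assms by simp
    then have "1 - b / (a + b) \<le> \<psi> (b / (a + b))"
      using psi assms by (auto simp: Psi_def)
    then have "(a + b) * (1 - b / (a + b)) \<le> F a b"
      unfolding F_def using pos by (intro mult_left_mono) auto
    moreover have "(a + b) * (1 - b / (a + b)) = a"
      using pos by (simp add: right_diff_distrib)
    ultimately show ?thesis by simp
  qed
  show "b \<le> F a b"
  proof (cases "a + b = 0")
    case True then show ?thesis using assms by (simp add: F_def)
  next
    case False
    then have pos: "a + b > 0" using assms by simp
    then have "b / (a + b) \<le> \<psi> (b / (a + b))"
      using psi assms by (auto simp: Psi_def)
    then have "(a + b) * (b / (a + b)) \<le> F a b"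
      unfolding F_def using pos by (intro mult_left_mono) auto
    then show ?thesis using pos by simp
  qed
qed

private lemma F_add:
  assumes "0 \<le> a" "0 \<le> b" "0 \<le> c" "0 \<le> d"
  shows "F (a + c) (b + d) \<le> F a b + F c d"
proof (cases "a + b = 0 \<or> c + d = 0")
  case True
  then have "a = 0 \<and> b = 0 \<or> c = 0 \<and> d = 0" using assms by linarith
  then show ?thesis by (auto simp: F_def)
next
  case False
  define s t where "s = a + b" and "t = c + d"
  have st: "s > 0" "t > 0" using False assms by (auto simp: s_def t_def)
  have cv: "convex_on {0..1} \<psi>" using psi by (simp add: Psi_def)
  have "\<psi> ((1 - t / (s + t)) *\<^sub>R (b / s) + (t / (s + t)) *\<^sub>R (d / t))
      \<le> (1 - t / (s + t)) * \<psi> (b / s) + (t / (s + t)) * \<psi> (d / t)"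
    by (rule convex_onD[OF cv]) (use st assms in \<open>auto simp: s_def t_def\<close>)
  moreover have e: "1 - t / (s + t) = s / (s + t)" using st by (simp add: field_simps)
  moreover have "(s / (s + t)) *\<^sub>R (b / s) + (t / (s + t)) *\<^sub>R (d / t) = (b + d) / (s + t)"
    using st by (simp add: add_divide_distrib)
  ultimately have "\<psi> ((b + d) / (s + t)) \<le> (s * \<psi> (b / s) + t * \<psi> (d / t)) / (s + t)"
    by (simp add: add_divide_distrib)
  then have "(s + t) * \<psi> ((b + d) / (s + t)) \<le> s * \<psi> (b / s) + t * \<psi> (d / t)"
    using st by (simp add: field_simps)
  then show ?thesis
    by (simp add: F_def s_def t_def algebra_simps)
qed

private lemma F_scale: "0 \<le> r \<Longrightarrow> F (r * a) (r * b) = r * F a b"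
  by (cases "r = 0") (simp_all add: F_def flip: distrib_left)

private lemma F_axes: "F 0 b = b" "F a 0 = a"
  using psi by (auto simp: F_def Psi_def divide_self_if)

private lemma F_mono:
  assumes "0 \<le> a" "a \<le> a'" "0 \<le> b" "b \<le> b'"
  shows "F a b \<le> F a' b'"
proof -
  have 1: "F a b \<le> F a' b"
  proof (cases "a' = 0")
    case False
    define r where "r = a / a'"
    have r: "0 \<le> r" "r \<le> 1" "a = r * a'" using False assms by (auto simp: r_def)
    have "F a b = F (r * a' + 0) (r * b + (1 - r) * b)" by (simp add: r algebra_simps)
    also have "\<dots> \<le> F (r * a') (r * b) + F 0 ((1 - r) * b)"
      by (rule F_add) (use r assms in auto)
    also have "\<dots> = r * F a' b + (1 - r) * b" using r by (simp add: F_scale F_axes)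
    also have "\<dots> \<le> r * F a' b + (1 - r) * F a' b"
      using F_ge(2)[of a' b] r assms by (intro add_left_mono mult_left_mono) auto
    finally show ?thesis by (simp add: algebra_simps)
  qed (use assms in simp)
  have 2: "F a' b \<le> F a' b'"
  proof (cases "b' = 0")
    case False
    define r where "r = b / b'"
    have r: "0 \<le> r" "r \<le> 1" "b = r * b'" using False assms by (auto simp: r_def)
    have "F a' b = F (r * a' + (1 - r) * a') (r * b' + 0)" by (simp add: r algebra_simps)
    also have "\<dots> \<le> F (r * a') (r * b') + F ((1 - r) * a') 0"
      by (rule F_add) (use r assms in auto)
    also have "\<dots> = r * F a' b' + (1 - r) * a'" using r by (simp add: F_scale F_axes)
    also have "\<dots> \<le> r * F a' b' + (1 - r) * F a' b'"
      using F_ge(1)[of a' b'] r assms by (intro add_left_mono mult_left_mono) auto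
    finally show ?thesis by (simp add: algebra_simps)
  qed (use assms in simp)
  show ?thesis using 1 2 by simp
qed

private lemma psi_sum_norm_F: "psi_sum_norm \<psi> p = F (norm (fst p)) (norm (snd p))"
  by (simp add: psi_sum_norm_alt F_def)

lemma psi_sum_norm_ge:
  "norm (fst p) \<le> psi_sum_norm \<psi> p" "norm (snd p) \<le> psi_sum_norm \<psi> p"
  by (simp_all add: psi_sum_norm_F F_ge)

lemma psi_sum_norm_le: "psi_sum_norm \<psi> p \<le> norm (fst p) + norm (snd p)"
  using F_add[of "norm (fst p)" 0 0 "norm (snd p)"] by (simp add: psi_sum_norm_F F_axes)

lemma psi_sum_norm_triangle: "psi_sum_norm \<psi> (p + q) \<le> psi_sum_norm \<psi> p + psi_sum_norm \<psi> q"
proof -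
  have "psi_sum_norm \<psi> (p + q) \<le> F (norm (fst p) + norm (fst q)) (norm (snd p) + norm (snd q))"
    unfolding psi_sum_norm_F by (rule F_mono) (auto intro: norm_triangle_ineq)
  also have "\<dots> \<le> psi_sum_norm \<psi> p + psi_sum_norm \<psi> q"
    unfolding psi_sum_norm_F by (rule F_add) auto
  finally show ?thesis .
qed

lemma psi_sum_norm_eq_0_iff: "psi_sum_norm \<psi> p = 0 \<longleftrightarrow> p = 0"
proof
  assume "psi_sum_norm \<psi> p = 0"
  then show "p = 0"
    using psi_sum_norm_ge[of p] by (simp add: prod_eq_iff)
qed (simp add: psi_sum_norm_alt)

lemma psi_sum_norm_scaleC:
  "psi_sum_norm \<psi> (c *\<^sub>C p) = cmod c * psi_sum_norm \<psi> p"
  for p :: "'a::complex_normed_vector \<times> 'b::complex_normed_vector"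
  by (simp add: psi_sum_norm_F scaleC_prod_def norm_scaleC F_scale)

lemma Metric_space_psi_sum_norm: "Metric_space UNIV (\<lambda>p q. psi_sum_norm \<psi> (p - q))"
proof
  fix p q r :: "'a::real_normed_vector \<times> 'b::real_normed_vector"
  show "0 \<le> psi_sum_norm \<psi> (p - q)"
    using psi_sum_norm_ge(1)[of "p - q"] norm_ge_zero order_trans by blast
  show "psi_sum_norm \<psi> (p - q) = psi_sum_norm \<psi> (q - p)"
    by (simp add: psi_sum_norm_F norm_minus_commute)
  show "psi_sum_norm \<psi> (p - q) = 0 \<longleftrightarrow> p = q"
    by (simp add: psi_sum_norm_eq_0_iff)
  show "psi_sum_norm \<psi> (p - r) \<le> psi_sum_norm \<psi> (p - q) + psi_sum_norm \<psi> (q - r)"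
    using psi_sum_norm_triangle[of "p - q" "q - r"] by simp
qed

end

end

theory Submission
  imports Defs
begin

text \<open>Suppose the resolvent norm equals \<open>M\<close> at a point and let \<open>R\<close> be the resolvent there. Averaging the
  Neumann series over a small circle against a nonnegative kernel gives
  \<open>\<parallel>R + \<zeta> c R\<^sup>n\<^sup>+\<^sup>1\<parallel> \<le> M\<close> for some \<open>c > 0\<close> and all \<open>\<bar>\<zeta>\<bar> \<le> 1\<close>. By compactness there is a limit \<open>y = (u, v)\<close> of
  vectors \<open>R x\<^sub>k\<close> with \<open>\<parallel>x\<^sub>k\<parallel> \<le> 1\<close> and \<open>\<parallel>y\<parallel> = M\<close>, so \<open>\<parallel>y + \<zeta> c R\<^sup>n y\<parallel> \<le> M\<close>. Complex strict
  convexity of \<open>Y\<close> forces \<open>R y\<close> and \<open>R\<^sup>2 y\<close> into the one-dimensional summand unless the sum norm at \<open>y\<close> is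
  \<open>\<bar>v\<bar>\<close>; by injectivity of \<open>R\<close> the latter must hold. Hence the coordinate functional \<open>e\<^sup>*\<close> satisfies
  \<open>\<parallel>e\<^sup>* R\<parallel> = M\<close>, and the same argument in the dual gives \<open>\<bar>e\<^sup>* R e\<bar> = M\<close> and \<open>e\<^sup>* R\<^sup>2 e = 0\<close>, where
  \<open>e = (0, 1)\<close>. With \<open>\<beta> = e\<^sup>* R e\<close>, reflecting the \<open>Y\<close>-component of \<open>R e / \<beta>\<close> yields the vector
  \<open>p = 2 e - R e / \<beta>\<close> of norm at most \<open>1\<close>, but \<open>e\<^sup>* R p = 2 \<beta>\<close> has modulus \<open>2 M\<close>.\<close>

section \<open>Complex strict convexity and gauges\<close>

interpretation cvs: vector_space "scaleC :: complex \<Rightarrow> 'a::complex_vector \<Rightarrow> 'a"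
  by standard (simp_all add: scaleC_add_right scaleC_add_left scaleC_scaleC)

text \<open>This is strict log-subharmonicity of the norm in a discrete form, which avoids norming functionals:
  if all four-point sums were at most \<open>4 \<parallel>u\<parallel>\<close>, then multiplying by the scalar factor \<open>1 - \<eta> z\<close> that flattens
  the norm to first order would push the average below the value at the centre.\<close>

lemma complex_strictly_convex_four_points:
  fixes u k :: "'a::complex_normed_vector"
  assumes csc: "complex_strictly_convex TYPE('a)" and "k \<noteq> 0"
  obtains \<zeta> where "cmod \<zeta> \<le> 1"
    "4 * norm u < norm (u + \<zeta> *\<^sub>C k) + norm (u + (- \<zeta>) *\<^sub>C k)
      + norm (u + (\<i> * \<zeta>) *\<^sub>C k) + norm (u + (- \<i> * \<zeta>) *\<^sub>C k)"
proof (rule ccontr)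
  assume "\<not> thesis"
  with that have sum_le: "norm (u + \<zeta> *\<^sub>C k) + norm (u + (- \<zeta>) *\<^sub>C k)
      + norm (u + (\<i> * \<zeta>) *\<^sub>C k) + norm (u + (- \<i> * \<zeta>) *\<^sub>C k) \<le> 4 * norm u"
    if "cmod \<zeta> \<le> 1" for \<zeta> :: complex
    using that by force
  define a where "a = norm u"
  show False
  proof (cases "a = 0")
    case True
    then have "norm k \<le> 0" using sum_le[of 1] by (simp add: a_def norm_scaleC norm_mult)
    with \<open>k \<noteq> 0\<close> show False by simp
  next
    case False
    then have a: "a > 0" by (simp add: a_def)
    \<comment> \<open>The norm is in fact constant on the disc. Antipodal pairs sum to at least
      \<open>2 * a\<close>, so under the assumed bound each pair sums to exactly
      \<open>2 * a\<close>; only an odd deviation \<open>\<eta>\<close> remains to be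
      excluded.\<close>
    have le_a: "norm (u + \<zeta> *\<^sub>C k) \<le> a" if z: "cmod \<zeta> \<le> 1" for \<zeta>
    proof -
      have pair: "2 * a \<le> norm (u + c *\<^sub>C k) + norm (u + (- c) *\<^sub>C k)" for c
      proof -
        have "2 *\<^sub>C u = (u + c *\<^sub>C k) + (u + (- c) *\<^sub>C k)"
          using scaleC_add_left[of 1 1 u] by (simp add: algebra_simps)
        then have "norm (2 *\<^sub>C u) \<le> norm (u + c *\<^sub>C k) + norm (u + (- c) *\<^sub>C k)"
          using norm_triangle_ineq by metis
        then show ?thesis by (simp add: norm_scaleC a_def)
      qed
      define p where "p = norm (u + \<zeta> *\<^sub>C k)"
      have m: "norm (u + (- \<zeta>) *\<^sub>C k) = 2 * a - p"
        and i: "norm (u + (\<i> * \<zeta>) *\<^sub>C k) + norm (u + (- \<i> * \<zeta>) *\<^sub>C k) = 2 * a"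
        using sum_le[OF z] pair[of \<zeta>] pair[of "\<i> * \<zeta>"] by (auto simp: p_def a_def)
      have "0 \<le> 2 * a - p" unfolding m[symmetric] by (rule norm_ge_zero)
      then have p: "0 \<le> p" "p \<le> 2 * a" by (simp_all add: p_def)
      define \<eta> where "\<eta> = (p - a) / a"
      have eta: "\<bar>\<eta>\<bar> \<le> 1" using p a by (auto simp: \<eta>_def abs_le_iff field_simps)
      have eta_a: "\<eta> * a = p - a" using a by (simp add: \<eta>_def)
      \<comment> \<open>The weights are \<open>1 - \<eta> * z\<close> at
        \<open>z = 1, -1, \<i>, - \<i>\<close>. They sum to 4, and their sum against
        \<open>z\<close> vanishes because the sums of \<open>z\<close> and of its square over these
        points do.\<close>
      have "4 *\<^sub>C u = of_real (1 - \<eta>) *\<^sub>C (u + \<zeta> *\<^sub>C k) + of_real (1 + \<eta>) *\<^sub>C (u + (- \<zeta>) *\<^sub>C k)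
          + (1 - \<i> * \<eta>) *\<^sub>C (u + (\<i> * \<zeta>) *\<^sub>C k) + (1 + \<i> * \<eta>) *\<^sub>C (u + (- \<i> * \<zeta>) *\<^sub>C k)"
        (is "_ = ?A + ?B + ?C + ?D")
      proof -
        have "?A + ?B + ?C + ?D = (of_real (1 - \<eta>) + of_real (1 + \<eta>) + (1 - \<i> * \<eta>) + (1 + \<i> * \<eta>)) *\<^sub>C u
          + (of_real (1 - \<eta>) * \<zeta> + of_real (1 + \<eta>) * (- \<zeta>) + (1 - \<i> * \<eta>) * (\<i> * \<zeta>)
              + (1 + \<i> * \<eta>) * (- \<i> * \<zeta>)) *\<^sub>C k"
          unfolding scaleC_add_left scaleC_add_right scaleC_scaleC by (simp only: add_ac)
        also have "of_real (1 - \<eta>) + of_real (1 + \<eta>) + (1 - \<i> * \<eta>) + (1 + \<i> * \<eta>) = (4::complex)"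
          by simp
        also have "of_real (1 - \<eta>) * \<zeta> + of_real (1 + \<eta>) * (- \<zeta>) + (1 - \<i> * \<eta>) * (\<i> * \<zeta>)
              + (1 + \<i> * \<eta>) * (- \<i> * \<zeta>) = 0"
          by (simp add: algebra_simps)
        finally show ?thesis by simp
      qed
      then have "norm (4 *\<^sub>C u) \<le> norm ?A + norm ?B + norm ?C + norm ?D"
        using norm_triangle_ineq[of "?A + ?B + ?C" ?D] norm_triangle_ineq[of "?A + ?B" ?C]
          norm_triangle_ineq[of ?A ?B] by (simp only:)
      also have "norm ?A = (1 - \<eta>) * p"
        using eta by (simp add: norm_scaleC p_def del: of_real_diff)
      also have "norm ?B = (1 + \<eta>) * (2 * a - p)"
        using eta by (simp only: norm_scaleC norm_of_real m)
      also have "cmod (1 - \<i> * \<eta>) = sqrt (1 + \<eta>\<^sup>2)" "cmod (1 + \<i> * \<eta>) = sqrt (1 + \<eta>\<^sup>2)"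
        by (simp_all add: cmod_def)
      then have "norm ?C + norm ?D = sqrt (1 + \<eta>\<^sup>2) * (2 * a)"
        by (simp only: norm_scaleC i flip: distrib_left)
      then have "(1 - \<eta>) * p + (1 + \<eta>) * (2 * a - p) + norm ?C + norm ?D
          = (1 - \<eta>) * p + (1 + \<eta>) * (2 * a - p) + sqrt (1 + \<eta>\<^sup>2) * (2 * a)"
        by simp
      also have "sqrt (1 + \<eta>\<^sup>2) \<le> 1 + \<eta>\<^sup>2 / 2"
        by (rule real_le_lsqrt) (simp_all add: power2_sum)
      finally have "4 * a \<le> (1 - \<eta>) * p + (1 + \<eta>) * (2 * a - p) + (1 + \<eta>\<^sup>2 / 2) * (2 * a)"
        using a by (simp add: norm_scaleC a_def[symmetric])
      \<comment> \<open>The second-order cost \<open>\<eta> * (\<eta> * a)\<close> of the two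
        imaginary weights is only half of the gain \<open>2 * \<eta> * (p - a)\<close>, which forces
        \<open>\<eta> = 0\<close>.\<close>
      also have "\<dots> = 4 * a - 2 * \<eta> * (p - a) + \<eta> * (\<eta> * a)"
        by (simp add: power2_eq_square algebra_simps)
      also have "\<dots> = 4 * a - \<eta> * (\<eta> * a)"
        by (simp add: eta_a)
      finally have "\<eta>\<^sup>2 * a \<le> 0" by (simp add: power2_eq_square)
      then have "\<eta> = 0" using a by (simp add: mult_le_0_iff)
      then show ?thesis using eta_a by (simp add: p_def)
    qed
    have "of_real (1 / a) *\<^sub>C k = 0"
    proof (rule csc[unfolded complex_strictly_convex_def, rule_format])
      have "norm (of_real (1 / a) *\<^sub>C u + \<zeta> *\<^sub>C of_real (1 / a) *\<^sub>C k) \<le> 1" if "cmod \<zeta> \<le> 1" for \<zeta>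
      proof -
        have "of_real (1 / a) *\<^sub>C u + \<zeta> *\<^sub>C of_real (1 / a) *\<^sub>C k = of_real (1 / a) *\<^sub>C (u + \<zeta> *\<^sub>C k)"
          by (simp only: scaleC_add_right scaleC_scaleC mult.commute)
        then have "norm (of_real (1 / a) *\<^sub>C u + \<zeta> *\<^sub>C of_real (1 / a) *\<^sub>C k) = norm (u + \<zeta> *\<^sub>C k) / a"
          using a by (simp add: norm_scaleC norm_divide)
        then show ?thesis using le_a[OF that] a by simp
      qed
      moreover have "norm (of_real (1 / a) *\<^sub>C u) = 1"
        using a by (simp add: norm_scaleC norm_divide a_def)
      ultimately show "norm (of_real (1 / a) *\<^sub>C u) = 1 \<and>
        (\<forall>\<zeta>. cmod \<zeta> \<le> 1 \<longrightarrow> norm (of_real (1 / a) *\<^sub>C u + \<zeta> *\<^sub>C of_real (1 / a) *\<^sub>C k) \<le> 1)"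
        by blast
    qed
    then show False using a \<open>k \<noteq> 0\<close> by simp
  qed
qed

lemma complex_strictly_convex_complex: "complex_strictly_convex TYPE(complex)"
  unfolding complex_strictly_convex_def
proof (intro allI impI)
  fix x y :: complex
  assume *: "norm x = 1 \<and> (\<forall>\<zeta>. cmod \<zeta> \<le> 1 \<longrightarrow> norm (x + \<zeta> *\<^sub>C y) \<le> 1)"
  show "y = 0"
  proof (rule ccontr)
    assume y: "y \<noteq> 0"
    \<comment> \<open>Chosen to rotate \<open>y\<close> into the direction of \<open>x\<close>, so
      that the norm becomes \<open>1 + cmod y\<close>.\<close>
    let ?z = "x * cmod y / y"
    have "norm (x + ?z *\<^sub>C y) \<le> 1"
      using * y by (auto simp: norm_mult norm_divide)
    moreover have "x + ?z *\<^sub>C y = x * of_real (1 + cmod y)"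
      using y by (simp add: scaleC_complex_def algebra_simps)
    ultimately have "\<bar>1 + cmod y\<bar> \<le> 1"
      using * by (simp only: norm_mult norm_of_real) simp
    then show False using y by simp
  qed
qed

text \<open>Monotone norms on the nonnegative quadrant, isolated from \<psi> because the extremality
  argument runs twice: for the norm of the direct sum and for its dual norm. For
  \<open>r > 0\<close>, equality in \<open>scale\<close> follows by applying it again with
  \<open>1 / r\<close>.\<close>

locale gauge =
  fixes F :: "real \<Rightarrow> real \<Rightarrow> real"
  assumes add: "\<lbrakk>0 \<le> a; 0 \<le> b; 0 \<le> c; 0 \<le> d\<rbrakk> \<Longrightarrow> F (a + c) (b + d) \<le> F a b + F c d"
    and scale: "\<lbrakk>0 \<le> r; 0 \<le> a; 0 \<le> b\<rbrakk> \<Longrightarrow> F (r * a) (r * b) \<le> r * F a b"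
    and mono: "\<lbrakk>0 \<le> a; a \<le> a'; 0 \<le> b; b \<le> b'\<rbrakk> \<Longrightarrow> F a b \<le> F a' b'"
    and axis: "0 \<le> b \<Longrightarrow> F 0 b = b"
    and axis': "0 \<le> a \<Longrightarrow> F a 0 = a"
begin

lemma ge: "\<lbrakk>0 \<le> a; 0 \<le> b\<rbrakk> \<Longrightarrow> b \<le> F a b"
  using mono[of 0 a b b] axis by simp

lemma ge': "\<lbrakk>0 \<le> a; 0 \<le> b\<rbrakk> \<Longrightarrow> a \<le> F a b"
  using mono[of a a 0 b] axis' by simp

text \<open>The point \<open>(a, b)\<close> is a convex combination of \<open>(a', b)\<close> and
  \<open>(0, b)\<close>, and the gauge at the latter is its least possible value \<open>b\<close>.
  If moving on to \<open>a'\<close> does not raise the gauge, convexity leaves no room above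
  \<open>b\<close>.\<close>

lemma eq_snd_if_flat:
  assumes "0 \<le> a" "a < a'" "0 \<le> b" "F a' b \<le> F a b"
  shows "F a b = b"
proof -
  define r where "r = a / a'"
  have r: "0 \<le> r" "r < 1" "a = r * a'" using assms by (auto simp: r_def)
  have "F a b = F (r * a' + 0) (r * b + (1 - r) * b)"
    by (simp add: r algebra_simps)
  also have "\<dots> \<le> F (r * a') (r * b) + F 0 ((1 - r) * b)"
    by (rule add) (use r assms in auto)
  also have "\<dots> \<le> r * F a' b + (1 - r) * b"
    using scale[of r a' b] axis[of "(1 - r) * b"] r assms by simp
  also have "\<dots> \<le> r * F a b + (1 - r) * b"
    using assms r by (simp add: mult_left_mono)
  finally have "(1 - r) * F a b \<le> (1 - r) * b" by (simp add: algebra_simps)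
  then show ?thesis using r ge[of a b] assms by simp
qed

lemma four_point_average:
  assumes "\<And>j. j < 4 \<Longrightarrow> 0 \<le> f j" "\<And>j. j < 4 \<Longrightarrow> 0 \<le> g j"
    and "\<And>j. j < (4::nat) \<Longrightarrow> F (f j) (g j) \<le> B"
  shows "F ((f 0 + f 1 + f 2 + f 3) / 4) ((g 0 + g 1 + g 2 + g 3) / 4) \<le> B"
proof -
  have "F (f 0 + f 1 + f 2 + f 3) (g 0 + g 1 + g 2 + g 3)
      \<le> F (f 0) (g 0) + F (f 1) (g 1) + F (f 2) (g 2) + F (f 3) (g 3)"
    using add[of "f 0" "g 0" "f 1" "g 1"] add[of "f 0 + f 1" "g 0 + g 1" "f 2" "g 2"]
      add[of "f 0 + f 1 + f 2" "g 0 + g 1 + g 2" "f 3" "g 3"] assms(1,2) by simp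
  also have "\<dots> \<le> 4 * B"
    using assms(3)[of 0] assms(3)[of 1] assms(3)[of 2] assms(3)[of 3] by simp
  finally show ?thesis
    using scale[of "1/4" "f 0 + f 1 + f 2 + f 3" "g 0 + g 1 + g 2 + g 3"] assms(1,2) by simp
qed

text \<open>Four-point averages \<open>S\<close> and \<open>T\<close> of the component norms are at
  least \<open>norm u\<close> and \<open>norm v\<close>, yet do not raise the gauge. If
  \<open>k\<close> is nonzero, some \<open>S\<close> is strictly larger, so the gauge is flat in its
  first argument and equals \<open>norm v\<close>. If \<open>m\<close> is nonzero, some
  \<open>T\<close> exceeds \<open>norm v\<close>, and so does the gauge.\<close>

lemma complex_extreme:
  fixes u k :: "'a::complex_normed_vector" and v m :: complex
  assumes csc: "complex_strictly_convex TYPE('a)"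
    and le: "\<And>\<zeta>. cmod \<zeta> \<le> 1 \<Longrightarrow> F (norm (u + \<zeta> *\<^sub>C k)) (norm (v + \<zeta> * m)) \<le> F (norm u) (norm v)"
  shows "F (norm u) (norm v) \<noteq> norm v \<Longrightarrow> k = 0"
    and "F (norm u) (norm v) = norm v \<Longrightarrow> m = 0"
proof -
  define S where "S \<zeta> = (norm (u + \<zeta> *\<^sub>C k) + norm (u + (- \<zeta>) *\<^sub>C k)
      + norm (u + (\<i> * \<zeta>) *\<^sub>C k) + norm (u + (- \<i> * \<zeta>) *\<^sub>C k)) / 4" for \<zeta>
  define T where "T \<zeta> = (norm (v + \<zeta> *\<^sub>C m) + norm (v + (- \<zeta>) *\<^sub>C m)
      + norm (v + (\<i> * \<zeta>) *\<^sub>C m) + norm (v + (- \<i> * \<zeta>) *\<^sub>C m)) / 4" for \<zeta>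
  have four: "4 * norm x \<le> norm (x + \<zeta> *\<^sub>C y) + norm (x + (- \<zeta>) *\<^sub>C y)
      + norm (x + (\<i> * \<zeta>) *\<^sub>C y) + norm (x + (- \<i> * \<zeta>) *\<^sub>C y)" for x y :: "'b::complex_normed_vector" and \<zeta>
  proof -
    have "2 * norm x \<le> norm (x + c *\<^sub>C y) + norm (x + (- c) *\<^sub>C y)" for c
    proof -
      have "2 *\<^sub>R x = (x + c *\<^sub>C y) + (x + (- c) *\<^sub>C y)"
        by (simp add: scaleR_2)
      then have "norm (2 *\<^sub>R x) \<le> norm (x + c *\<^sub>C y) + norm (x + (- c) *\<^sub>C y)"
        using norm_triangle_ineq by metis
      then show ?thesis by simp
    qed
    from this[of \<zeta>] this[of "\<i> * \<zeta>"] show ?thesis by simp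
  qed
  have S: "norm u \<le> S \<zeta>" for \<zeta>
    using four[of u \<zeta> k] by (simp add: S_def le_divide_eq)
  have T: "norm v \<le> T \<zeta>" for \<zeta>
    using four[of v \<zeta> m] by (simp add: T_def le_divide_eq)
  have avg: "F (S \<zeta>) (T \<zeta>) \<le> F (norm u) (norm v)" if "cmod \<zeta> \<le> 1" for \<zeta>
  proof -
    define w where "w = (!) [\<zeta>, - \<zeta>, \<i> * \<zeta>, - \<i> * \<zeta>]"
    have w: "cmod (w j) \<le> 1" if "j < 4" for j
    proof -
      from that have "j = 0 \<or> j = 1 \<or> j = 2 \<or> j = 3" by auto
      then show ?thesis using \<open>cmod \<zeta> \<le> 1\<close> by (auto simp: w_def norm_mult)
    qed
    show ?thesis
      using four_point_average[of "\<lambda>j. norm (u + w j *\<^sub>C k)" "\<lambda>j. norm (v + w j * m)"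
          "F (norm u) (norm v)"] le[OF w]
      by (simp add: S_def T_def w_def scaleC_complex_def)
  qed
  show "k = 0" if "F (norm u) (norm v) \<noteq> norm v"
  proof (rule ccontr)
    assume "k \<noteq> 0"
    then obtain \<zeta> where z: "cmod \<zeta> \<le> 1" "norm u < S \<zeta>"
      by (rule complex_strictly_convex_four_points[OF csc, of k u])
        (rule that, assumption, simp add: S_def)
    have "F (S \<zeta>) (norm v) \<le> F (norm u) (norm v)"
      using mono[of "S \<zeta>" "S \<zeta>" "norm v" "T \<zeta>"] avg[OF z(1)] T[of \<zeta>] z(2) norm_ge_zero[of u]
        norm_ge_zero[of v] by linarith
    with eq_snd_if_flat[of "norm u" "S \<zeta>" "norm v"] z that show False by simp
  qed
  show "m = 0" if "F (norm u) (norm v) = norm v"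
  proof (rule ccontr)
    assume "m \<noteq> 0"
    then obtain \<zeta> where z: "cmod \<zeta> \<le> 1" "norm v < T \<zeta>"
      by (rule complex_strictly_convex_four_points[OF complex_strictly_convex_complex, of m v])
        (rule that, assumption, simp add: T_def)
    then show False
      using avg[OF z(1)] ge[of "S \<zeta>" "T \<zeta>"] that S[of \<zeta>] norm_ge_zero[of u] norm_ge_zero[of v]
      by linarith
  qed
qed

section \<open>The dual gauge\<close>

definition dual :: "real \<Rightarrow> real \<Rightarrow> real"
  where "dual \<alpha> \<beta> = (SUP (a, b) \<in> {(a, b). 0 \<le> a \<and> 0 \<le> b \<and> F a b \<le> 1}. \<alpha> * a + \<beta> * b)"

lemma dual_le:
  assumes "\<And>a b. \<lbrakk>0 \<le> a; 0 \<le> b; F a b \<le> 1\<rbrakk> \<Longrightarrow> \<alpha> * a + \<beta> * b \<le> C"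
  shows "dual \<alpha> \<beta> \<le> C"
  unfolding dual_def
proof (rule cSUP_least)
  show "{(a, b). 0 \<le> a \<and> 0 \<le> b \<and> F a b \<le> 1} \<noteq> {}"
    using axis[of 0] by (intro ex_in_conv[THEN iffD1] exI[of _ "(0, 0)"]) simp
qed (use assms in auto)

lemma dual_ge:
  assumes "0 \<le> \<alpha>" "0 \<le> \<beta>" "0 \<le> a" "0 \<le> b" "F a b \<le> 1"
  shows "\<alpha> * a + \<beta> * b \<le> dual \<alpha> \<beta>"
proof -
  \<comment> \<open>The unit region of the gauge lies in the unit square, so the supremum is taken
    over a set bounded above.\<close>
  have "\<alpha> * x + \<beta> * y \<le> \<alpha> * 1 + \<beta> * 1" if "0 \<le> x" "0 \<le> y" "F x y \<le> 1" for x y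
    using ge[of x y] ge'[of x y] that assms by (intro add_mono mult_left_mono) auto
  then have "bdd_above ((\<lambda>(a, b). \<alpha> * a + \<beta> * b) ` {(a, b). 0 \<le> a \<and> 0 \<le> b \<and> F a b \<le> 1})"
    by (intro bdd_aboveI[of _ "\<alpha> * 1 + \<beta> * 1"]) auto
  then show ?thesis
    unfolding dual_def by (rule cSUP_upper2[where x = "(a, b)"]) (use assms in auto)
qed

lemma dual_pairing:
  assumes "0 \<le> \<alpha>" "0 \<le> \<beta>" "0 \<le> a" "0 \<le> b"
  shows "\<alpha> * a + \<beta> * b \<le> dual \<alpha> \<beta> * F a b"
proof (cases "F a b = 0")
  case True
  then show ?thesis using ge[of a b] ge'[of a b] assms by simp
next
  case False
  then have pos: "0 < F a b" using ge[of a b] assms by simp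
  have "\<alpha> * (1 / F a b * a) + \<beta> * (1 / F a b * b) \<le> dual \<alpha> \<beta>"
    using scale[of "1 / F a b" a b] pos assms by (intro dual_ge) auto
  then show ?thesis using pos by (simp add: field_simps)
qed

text \<open>Suprema of linear forms with nonnegative coefficients inherit the first three laws. The
  values on the axes are exact because the unit region contains \<open>(1, 0)\<close> and
  \<open>(0, 1)\<close> and lies in the unit square.\<close>

lemma gauge_dual: "gauge dual"
proof
  fix a b c d :: real
  assume "0 \<le> a" "0 \<le> b" "0 \<le> c" "0 \<le> d"
  then show "dual (a + c) (b + d) \<le> dual a b + dual c d"
  proof (intro dual_le)
    fix x y :: real assume "0 \<le> x" "0 \<le> y" "F x y \<le> 1"
    then show "(a + c) * x + (b + d) * y \<le> dual a b + dual c d"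
      using dual_ge[of a b x y] dual_ge[of c d x y] \<open>0 \<le> a\<close> \<open>0 \<le> b\<close> \<open>0 \<le> c\<close> \<open>0 \<le> d\<close>
      by (simp add: algebra_simps)
  qed
next
  fix r a b :: real
  assume "0 \<le> r" "0 \<le> a" "0 \<le> b"
  then show "dual (r * a) (r * b) \<le> r * dual a b"
  proof (intro dual_le)
    fix x y :: real assume "0 \<le> x" "0 \<le> y" "F x y \<le> 1"
    then have "r * (a * x + b * y) \<le> r * dual a b"
      using dual_ge[of a b x y] \<open>0 \<le> r\<close> \<open>0 \<le> a\<close> \<open>0 \<le> b\<close> by (intro mult_left_mono) auto
    then show "r * a * x + r * b * y \<le> r * dual a b" by (simp add: algebra_simps)
  qed
next
  fix a a' b b' :: real
  assume *: "0 \<le> a" "a \<le> a'" "0 \<le> b" "b \<le> b'"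
  show "dual a b \<le> dual a' b'"
  proof (rule dual_le)
    fix x y :: real assume xy: "0 \<le> x" "0 \<le> y" "F x y \<le> 1"
    have "a * x + b * y \<le> a' * x + b' * y"
      using * xy by (intro add_mono mult_right_mono) auto
    then show "a * x + b * y \<le> dual a' b'"
      using dual_ge[of a' b' x y] * xy by simp
  qed
next
  fix b :: real assume b: "0 \<le> b"
  have "dual 0 b \<le> b"
  proof (rule dual_le)
    fix x y :: real assume "0 \<le> x" "0 \<le> y" "F x y \<le> 1"
    then show "0 * x + b * y \<le> b" using ge[of x y] b by (simp add: mult_left_le)
  qed
  moreover have "b \<le> dual 0 b"
    using dual_ge[of 0 b 0 1] axis[of 1] b by simp
  ultimately show "dual 0 b = b" by simp
next
  fix a :: real assume a: "0 \<le> a"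
  have "dual a 0 \<le> a"
  proof (rule dual_le)
    fix x y :: real assume "0 \<le> x" "0 \<le> y" "F x y \<le> 1"
    then show "a * x + 0 * y \<le> a" using ge'[of x y] a by (simp add: mult_left_le)
  qed
  moreover have "a \<le> dual a 0"
    using dual_ge[of a 0 1 0] axis'[of 1] a by simp
  ultimately show "dual a 0 = a" by simp
qed

end

section \<open>The \<psi>-norms as gauges\<close>

lemma psi_sum_norm_eq_psi_norm:
  "psi_sum_norm \<psi> p = psi_norm \<psi> (of_real (norm (fst p)), of_real (norm (snd p)))"
  by (simp add: psi_sum_norm_def split: prod.splits)

lemma gauge_psi_norm:
  assumes psi: "\<psi> \<in> Psi"
  shows "gauge (\<lambda>a b. psi_norm \<psi> (of_real a, of_real b))"
proof -
  define P :: "complex \<times> complex \<Rightarrow> real" where "P = psi_sum_norm \<psi>"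
  have P: "psi_norm \<psi> (of_real a, of_real b) = P (of_real a, of_real b)"
    if "0 \<le> a" "0 \<le> b" for a b
    using that by (simp add: P_def psi_sum_norm_def)
  have tri: "P (p + q) \<le> P p + P q" and sc: "P (c *\<^sub>C p) = cmod c * P p" for p q c
    by (simp_all add: P_def psi psi_sum_norm_triangle psi_sum_norm_scaleC)
  have Pabs: "P (z, w) = P (of_real (cmod z), of_real (cmod w))" for z w
    by (simp add: P_def psi_sum_norm_def)
  have axes: "P (0, of_real b) = b" "P (of_real b, 0) = b" if "0 \<le> b" for b
    using psi_sum_norm_le[OF psi, of "(0, complex_of_real b)"]
      psi_sum_norm_ge(2)[OF psi, of "(0::complex, complex_of_real b)"]
      psi_sum_norm_le[OF psi, of "(complex_of_real b, 0)"]
      psi_sum_norm_ge(1)[OF psi, of "(complex_of_real b, 0::complex)"] that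
    unfolding P_def by (auto intro!: antisym)
  have mix: "P ((t *\<^sub>C p) + ((1 - t) *\<^sub>C q)) \<le> P p" if "P q = P p" "0 \<le> t" "t \<le> 1"
    for p q and t :: real
  proof -
    have "P ((t *\<^sub>C p) + ((1 - t) *\<^sub>C q)) \<le> cmod t * P p + cmod (of_real (1 - t)) * P q"
      using tri[of "t *\<^sub>C p" "(1 - t) *\<^sub>C q"] by (simp only: sc of_real_diff of_real_1)
    also have "\<dots> = P p" using that by (simp only: norm_of_real) (simp add: algebra_simps)
    finally show ?thesis .
  qed
  \<comment> \<open>The point \<open>(a, w)\<close> lies on the segment from \<open>(a', w)\<close>
    to \<open>(- a', w)\<close>. These ends have equal norm, so convexity in the form
    \<open>mix\<close> gives monotonicity; \<open>?t\<close> is the barycentric weight.\<close>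
  have mono1: "P (of_real a, w) \<le> P (of_real a', w)" if "0 \<le> a" "a \<le> a'" for a a' w
  proof (cases "a' = 0")
    case False
    let ?t = "(1 + a / a') / 2"
    have "(complex_of_real a, w) = ?t *\<^sub>C (of_real a', w) + (1 - ?t) *\<^sub>C (- of_real a', w)"
      using False that by (simp add: scaleC_prod_def scaleC_complex_def field_simps)
    also have "P \<dots> \<le> P (of_real a', w)"
      using that False Pabs[of "- of_real a'" w] Pabs[of "of_real a'" w] by (intro mix) auto
    finally show ?thesis .
  qed (use that in simp)
  have mono2: "P (w, of_real a) \<le> P (w, of_real a')" if "0 \<le> a" "a \<le> a'" for a a' w
  proof (cases "a' = 0")
    case False
    let ?t = "(1 + a / a') / 2"
    have "(w, complex_of_real a) = ?t *\<^sub>C (w, of_real a') + (1 - ?t) *\<^sub>C (w, - of_real a')"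
      using False that by (simp add: scaleC_prod_def scaleC_complex_def field_simps)
    also have "P \<dots> \<le> P (w, of_real a')"
      using that False Pabs[of w "- of_real a'"] Pabs[of w "of_real a'"] by (intro mix) auto
    finally show ?thesis .
  qed (use that in simp)
  show ?thesis
  proof
    fix a b c d :: real
    assume "0 \<le> a" "0 \<le> b" "0 \<le> c" "0 \<le> d"
    then show "psi_norm \<psi> (of_real (a + c), of_real (b + d))
        \<le> psi_norm \<psi> (of_real a, of_real b) + psi_norm \<psi> (of_real c, of_real d)"
      using tri[of "(of_real a, of_real b)" "(of_real c, of_real d)"] by (simp add: P del: of_real_add) simp
  next
    fix r a b :: real
    assume "0 \<le> r" "0 \<le> a" "0 \<le> b"
    then show "psi_norm \<psi> (of_real (r * a), of_real (r * b)) \<le> r * psi_norm \<psi> (of_real a, of_real b)"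
      using sc[of r "(of_real a, of_real b)"]
      by (simp add: P scaleC_prod_def scaleC_complex_def del: of_real_mult) simp
  next
    fix a a' b b' :: real
    assume "0 \<le> a" "a \<le> a'" "0 \<le> b" "b \<le> b'"
    then show "psi_norm \<psi> (of_real a, of_real b) \<le> psi_norm \<psi> (of_real a', of_real b')"
      using mono1[of a a' "of_real b"] mono2[of b b' "of_real a'"] by (simp add: P)
  next
    fix b :: real
    assume b: "0 \<le> b"
    show "psi_norm \<psi> (of_real 0, of_real b) = b" "psi_norm \<psi> (of_real b, of_real 0) = b"
      using P[of 0 b] P[of b 0] axes[OF b] b by auto
  qed
qed

section \<open>Averages over roots of unity\<close>

text \<open>A geometric sum in a \<open>K\<close>-th root of unity \<open>z\<close>, where
  \<open>z = 1\<close> exactly when \<open>K\<close> divides \<open>m\<close>.\<close>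

lemma sum_roots_of_unity_power:
  fixes K m :: nat
  assumes "0 < K"
  shows "(\<Sum>j<K. cis (2 * pi * j / K) ^ m) = (if K dvd m then of_nat K else 0)"
proof -
  define z where "z = cis (2 * pi * m / K)"
  have pow: "cis (2 * pi * j / K) ^ m = z ^ j" for j :: nat
    by (simp add: z_def Complex.DeMoivre mult_ac)
  have z1: "z = 1 \<longleftrightarrow> K dvd m"
  proof -
    have "z = exp (2 * of_real pi * \<i> * of_nat m / of_nat K)"
      by (simp add: z_def cis_conv_exp mult_ac)
    moreover have "exp (2 * of_real pi * \<i> * of_nat m / of_nat K)
        = exp (2 * of_real pi * \<i> * of_nat 0 / of_nat K) \<longleftrightarrow> m mod K = 0 mod K"
      by (rule complex_root_unity_eq) (use assms in simp)
    ultimately show ?thesis by (simp add: mod_eq_0_iff_dvd)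
  qed
  show ?thesis
  proof (cases "K dvd m")
    case True
    then show ?thesis using z1 by (simp add: pow)
  next
    case False
    have "z ^ K = cis (2 * pi * m)"
      using assms by (simp add: z_def Complex.DeMoivre)
    also have "\<dots> = 1"
      by (metis cis_multiple_2pi Ints_of_nat)
    finally have "z ^ K = 1" .
    then show ?thesis
      using False z1 by (simp add: pow geometric_sum)
  qed
qed

lemma norm_like_sum_le:
  fixes N :: "'v::complex_vector \<Rightarrow> real"
  assumes tri: "\<And>p q. N (p + q) \<le> N p + N q" and sc: "\<And>c p. N (c *\<^sub>C p) = cmod c * N p"
  shows "N (\<Sum>j\<in>J. f j) \<le> (\<Sum>j\<in>J. N (f j))"
proof -
  have "N 0 = 0" using sc[of 0 0] by simp
  then show ?thesis
    by (induction J rule: infinite_finite_induct) (auto intro!: order_trans[OF tri] add_left_mono)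
qed

text \<open>The weights are the values of the kernel \<open>1 + Re (\<xi> z\<^sup>-\<^sup>n)\<close> at the \<open>K\<close>-th roots of unity: they are
  nonnegative, and of the first \<open>K\<close> Fourier coefficients only \<open>0\<close>, \<open>n\<close> and \<open>K - n\<close> survive.\<close>

lemma Fejer_average:
  fixes N :: "'v::complex_vector \<Rightarrow> real" and f :: "complex \<Rightarrow> 'v" and a :: "nat \<Rightarrow> 'v"
  assumes tri: "\<And>p q. N (p + q) \<le> N p + N q" and sc: "\<And>c p. N (c *\<^sub>C p) = cmod c * N p"
    and f: "\<And>z. cmod z = r \<Longrightarrow> N (f z) \<le> B"
    and rem: "\<And>z. cmod z = r \<Longrightarrow> N (f z - (\<Sum>k<K. z ^ k *\<^sub>C a k)) \<le> E"
    and n: "0 < n" "2 * n < K" and xi: "cmod \<xi> \<le> 1" and r: "0 \<le> r"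
  shows "N (a 0 + (\<xi> / 2 * r ^ n) *\<^sub>C a n) \<le> B + E + r ^ (K - n) * N (a (K - n))"
proof -
  define \<omega> where "\<omega> = (\<lambda>j. cis (2 * pi * real j / real K))"
  define w where "w = (\<lambda>j. (1 + Re (\<xi> * cnj (\<omega> j) ^ n)) / K)"
  have K: "0 < K" using n by simp
  \<comment> \<open>Conjugation inverts a root of unity, so \<open>cnj (\<omega> j) ^ n\<close> is
    \<open>\<omega> j ^ (K - n)\<close> and each weight is a polynomial in
    \<open>\<omega> j\<close>.\<close>
  have w_complex: "of_real (w j) = (1 + (\<xi> / 2) * \<omega> j ^ (K - n) + (cnj \<xi> / 2) * \<omega> j ^ n) / of_nat K" for j
  proof -
    have "\<omega> j ^ K = cis (2 * pi * j)" using K by (simp add: \<omega>_def Complex.DeMoivre)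
    also have "\<dots> = 1" by (metis cis_multiple_2pi Ints_of_nat)
    finally have "\<omega> j ^ (K - n) * \<omega> j ^ n = 1"
      using n by (simp flip: power_add)
    moreover have "cnj (\<omega> j) ^ n * \<omega> j ^ n = 1"
      by (simp add: \<omega>_def flip: power_mult_distrib) (simp add: cis_cnj cis_mult)
    ultimately have e: "cnj (\<omega> j) ^ n = \<omega> j ^ (K - n)"
      by (metis mult_right_cancel mult_zero_right zero_neq_one)
    have "complex_of_real (Re x) = (x + cnj x) / 2" for x
      by (simp add: complex_add_cnj)
    from this[of "\<xi> * cnj (\<omega> j) ^ n"]
    have "of_real (Re (\<xi> * cnj (\<omega> j) ^ n)) = (\<xi> * \<omega> j ^ (K - n) + cnj \<xi> * \<omega> j ^ n) / 2"
      by (simp only: e[symmetric] complex_cnj_mult complex_cnj_power complex_cnj_cnj)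
    then show ?thesis by (simp add: w_def add_divide_distrib del: times_complex.sel)
  qed
  have coeff: "(\<Sum>j<K. of_real (w j) * \<omega> j ^ k)
      = (if k = 0 then 1 else 0) + (if k = n then \<xi> / 2 else 0) + (if k = K - n then cnj \<xi> / 2 else 0)"
    if "k < K" for k
  proof -
    have "(\<Sum>j<K. of_real (w j) * \<omega> j ^ k) = ((\<Sum>j<K. \<omega> j ^ k)
        + (\<xi> / 2) * (\<Sum>j<K. \<omega> j ^ (k + (K - n))) + (cnj \<xi> / 2) * (\<Sum>j<K. \<omega> j ^ (k + n))) / of_nat K"
      by (simp add: w_complex sum_divide_distrib sum_distrib_left sum.distrib[symmetric] power_add
          algebra_simps add_divide_distrib)
    moreover have "(\<Sum>j<K. \<omega> j ^ m) = (if K dvd m then of_nat K else 0)" for m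
      unfolding \<omega>_def by (rule sum_roots_of_unity_power[OF K])
    moreover have "K dvd k \<longleftrightarrow> k = 0"
      using that by (auto dest: dvd_imp_le)
    moreover have "K dvd k + (K - n) \<longleftrightarrow> k = n"
    proof
      assume "K dvd k + (K - n)"
      then obtain q where q: "k + (K - n) = K * q" by auto
      then have "K * q < K * 2" "0 < K * q" using that n by linarith+
      then have "q = 1" by auto
      then show "k = n" using q n by simp
    qed (use n in simp)
    moreover have "K dvd k + n \<longleftrightarrow> k = K - n"
    proof
      assume "K dvd k + n"
      then obtain q where q: "k + n = K * q" by auto
      then have "K * q < K * 2" "0 < K * q" using that n by linarith+
      then have "q = 1" by auto
      then show "k = K - n" using q n by simp
    qed (use n in simp)
    ultimately show ?thesis
      using K n by (auto simp: add_divide_distrib)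
  qed
  have w_nonneg: "0 \<le> w j" for j
  proof -
    have "\<bar>Re (\<xi> * cnj (\<omega> j) ^ n)\<bar> \<le> cmod (\<xi> * cnj (\<omega> j) ^ n)" by (rule abs_Re_le_cmod)
    also have "\<dots> \<le> 1" using xi by (simp add: norm_mult norm_power \<omega>_def)
    finally show ?thesis by (simp add: w_def abs_le_iff)
  qed
  have w_sum: "(\<Sum>j<K. w j) = 1"
  proof -
    have "of_real (\<Sum>j<K. w j) = (1 :: complex)"
      using coeff[of 0] n by simp
    then show ?thesis by (simp only: of_real_eq_1_iff)
  qed
  define z where "z j = of_real r * \<omega> j" for j
  have z: "cmod (z j) = r" for j using r by (simp add: z_def \<omega>_def norm_mult)
  define g where "g j = f (z j) - (\<Sum>k<K. z j ^ k *\<^sub>C a k)" for j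
  have "(\<Sum>j<K. of_real (w j) *\<^sub>C (\<Sum>k<K. z j ^ k *\<^sub>C a k))
      = (\<Sum>j<K. \<Sum>k<K. (of_real (w j) * z j ^ k) *\<^sub>C a k)"
    by (simp only: cvs.scale_sum_right scaleC_scaleC)
  also have "\<dots> = (\<Sum>k<K. \<Sum>j<K. (of_real (w j) * z j ^ k) *\<^sub>C a k)"
    by (rule sum.swap)
  also have "\<dots> = (\<Sum>k<K. (\<Sum>j<K. of_real (w j) * z j ^ k) *\<^sub>C a k)"
    by (simp only: cvs.scale_sum_left)
  also have "\<dots> = (\<Sum>k<K. (r ^ k * (\<Sum>j<K. of_real (w j) * \<omega> j ^ k)) *\<^sub>C a k)"
    by (simp only: z_def power_mult_distrib sum_distrib_left mult.left_commute of_real_power)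
  also have "\<dots> = (\<Sum>k<K. (if k = 0 then a 0 else 0) + (if k = n then (\<xi> / 2 * r ^ n) *\<^sub>C a n else 0)
      + (if k = K - n then (cnj \<xi> / 2 * r ^ (K - n)) *\<^sub>C a (K - n) else 0))"
    by (rule sum.cong) (use n in \<open>auto simp: coeff mult_ac\<close>)
  also have "\<dots> = a 0 + (\<xi> / 2 * r ^ n) *\<^sub>C a n + (cnj \<xi> / 2 * r ^ (K - n)) *\<^sub>C a (K - n)"
    using n by (simp add: sum.distrib)
  \<comment> \<open>Solved for the wanted combination: the average of \<open>f\<close>, the averaged
    remainder, and the aliasing term at \<open>K - n\<close>, which is the price of averaging over
    finitely many points.\<close>
  finally have "a 0 + (\<xi> / 2 * r ^ n) *\<^sub>C a n = (\<Sum>j<K. of_real (w j) *\<^sub>C f (z j))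
      + ((\<Sum>j<K. of_real (- w j) *\<^sub>C g j) + (- (cnj \<xi> / 2 * r ^ (K - n))) *\<^sub>C a (K - n))"
    by (simp add: g_def sum.distrib sum_subtractf sum_negf cvs.scale_right_diff_distrib algebra_simps)
  then have "N (a 0 + (\<xi> / 2 * r ^ n) *\<^sub>C a n) \<le> N (\<Sum>j<K. of_real (w j) *\<^sub>C f (z j))
      + (N (\<Sum>j<K. of_real (- w j) *\<^sub>C g j) + N ((- (cnj \<xi> / 2 * r ^ (K - n))) *\<^sub>C a (K - n)))"
    by (simp only: order_trans[OF tri add_left_mono[OF tri]])
  also have "N (\<Sum>j<K. of_real (w j) *\<^sub>C f (z j)) \<le> (\<Sum>j<K. N (of_real (w j) *\<^sub>C f (z j)))"
    by (rule norm_like_sum_le[OF tri sc])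
  also have "\<dots> \<le> (\<Sum>j<K. w j * B)"
    by (rule sum_mono) (auto simp: sc w_nonneg z intro!: mult_left_mono f)
  also have "\<dots> = B" by (simp add: w_sum flip: sum_distrib_right)
  also have "N (\<Sum>j<K. of_real (- w j) *\<^sub>C g j) \<le> (\<Sum>j<K. N (of_real (- w j) *\<^sub>C g j))"
    by (rule norm_like_sum_le[OF tri sc])
  also have "\<dots> \<le> (\<Sum>j<K. w j * E)"
    using rem[OF z] by (intro sum_mono) (auto simp only: sc w_nonneg norm_of_real g_def abs_minus_cancel abs_of_nonneg intro!: mult_left_mono)
  also have "\<dots> = E" by (simp add: w_sum flip: sum_distrib_right)
  also have "N ((- (cnj \<xi> / 2 * r ^ (K - n))) *\<^sub>C a (K - n)) \<le> r ^ (K - n) * N (a (K - n))"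
  proof -
    have "0 \<le> N (a (K - n))"
      using tri[of "a (K - n)" "(-1) *\<^sub>C a (K - n)"] sc[of "-1" "a (K - n)"] sc[of 0 0] by simp
    moreover have "cmod (- (cnj \<xi> / 2 * r ^ (K - n))) = cmod \<xi> / 2 * r ^ (K - n)"
      using r by (simp add: norm_mult norm_divide norm_power)
    moreover have "cmod \<xi> / 2 * r ^ (K - n) \<le> 1 * r ^ (K - n)"
      using xi r by (intro mult_right_mono) auto
    ultimately show ?thesis
      unfolding sc by (intro mult_right_mono) (simp_all only: mult_1)
  qed
  finally show ?thesis by simp
qed


section \<open>Operators attaining an extremal norm\<close>

lemma clinear_onD:
  assumes "clinear_on UNIV f"
  shows "f (x + y) = f x + f y" "f (c *\<^sub>C x) = c *\<^sub>C f x" "f 0 = 0" "f (x - y) = f x - f y"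
proof -
  show add: "f (x + y) = f x + f y" for x y using assms by (simp add: clinear_on_def)
  show scale: "f (c *\<^sub>C x) = c *\<^sub>C f x" for c x using assms by (simp add: clinear_on_def)
  show "f 0 = 0" using scale[of 0 0] by simp
  show "f (x - y) = f x - f y" using add[of "x - y" y] by (simp add: algebra_simps)
qed

lemma clinear_on_UNIV_iff:
  "clinear_on UNIV f \<longleftrightarrow> (\<forall>x y. f (x + y) = f x + f y) \<and> (\<forall>c x. f (c *\<^sub>C x) = c *\<^sub>C f x)"
  by (simp add: clinear_on_def csubspace_def)

lemma clinear_on_funpow:
  fixes f :: "'a::complex_vector \<Rightarrow> 'a"
  assumes "clinear_on UNIV f"
  shows "clinear_on UNIV (f ^^ n)"
  using assms by (induction n) (simp_all add: clinear_on_UNIV_iff)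

lemma snd_scaleC [simp]: "snd (c *\<^sub>C p) = c *\<^sub>C snd p"
  and fst_scaleC [simp]: "fst (c *\<^sub>C p) = c *\<^sub>C fst p"
  by (simp_all add: scaleC_prod_def)

section \<open>Functionals on the direct sum and their norms\<close>

lemma functional_on_sum_rep:
  fixes h :: "'y::complex_normed_vector \<times> complex \<Rightarrow> complex"
  assumes lin: "clinear_on UNIV h" and bound: "\<And>x. cmod (h (x, 0)) \<le> C * norm x"
  obtains g :: "'y cdual" where "\<And>x z. h (x, z) = blinfun_apply (Rep_cdual g) x + z * h (0, 1)"
proof (rule that)
  let ?h = "\<lambda>x. h (x, 0)"
  have sc: "h (c *\<^sub>C x, 0) = c * h (x, 0)" for c x
    using clinear_onD(2)[OF lin, of c "(x, 0)"] by (simp add: scaleC_prod_def scaleC_complex_def)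
  have "bounded_linear ?h"
  proof (rule bounded_linear_intro[where K = C])
    show "h (x + y, 0) = h (x, 0) + h (y, 0)" for x y
      using clinear_onD(1)[OF lin, of "(x, 0)" "(y, 0)"] by simp
    show "h (r *\<^sub>R x, 0) = r *\<^sub>R h (x, 0)" for r x
      using sc[of r x] by (simp add: scaleC_of_real scaleR_conv_of_real)
  qed (use bound in \<open>simp add: mult.commute\<close>)
  then have rep: "blinfun_apply (Rep_cdual (Abs_cdual (Blinfun ?h))) x = h (x, 0)" for x
    by (subst Abs_cdual_inverse) (simp_all add: bounded_linear_Blinfun_apply sc)
  have "h (x, z) = h (x, 0) + z * h (0, 1)" for x z
    using clinear_onD(1)[OF lin, of "(x, 0)" "z *\<^sub>C (0, 1)"] clinear_onD(2)[OF lin, of z "(0, 1)"]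
    by (simp add: scaleC_prod_def scaleC_complex_def)
  then show "h (x, z) = blinfun_apply (Rep_cdual (Abs_cdual (Blinfun ?h))) x + z * h (0, 1)" for x z
    unfolding rep .
qed

text \<open>The dual gauge at \<open>(norm g, cmod \<beta>)\<close> is the operator norm of the
  functional with components \<open>g\<close> and \<open>\<beta>\<close>. One direction is
  \<open>dual_pairing\<close>. For the other, rotating the phases of \<open>x\<close> and
  \<open>z\<close> makes the two contributions add up, and the unit vectors \<open>x\<close>
  together recover \<open>norm g\<close>.\<close>

lemma (in gauge) dual_norm_le_iff:
  fixes g :: "'y::complex_normed_vector cdual"
  shows "dual (norm g) (cmod \<beta>) \<le> C \<longleftrightarrow>
    (\<forall>x z. cmod (blinfun_apply (Rep_cdual g) x + z * \<beta>) \<le> C * F (norm x) (cmod z))"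
proof (intro iffI allI)
  fix x z
  assume le: "dual (norm g) (cmod \<beta>) \<le> C"
  have "cmod (blinfun_apply (Rep_cdual g) x + z * \<beta>) \<le> norm g * norm x + cmod \<beta> * cmod z"
    using norm_triangle_ineq[of "blinfun_apply (Rep_cdual g) x" "z * \<beta>"]
      norm_blinfun[of "Rep_cdual g" x] by (simp add: norm_mult mult.commute norm_cdual_def)
  also have "\<dots> \<le> dual (norm g) (cmod \<beta>) * F (norm x) (cmod z)"
    by (rule dual_pairing) auto
  also have "\<dots> \<le> C * F (norm x) (cmod z)"
    by (rule mult_right_mono[OF le]) (rule order_trans[OF _ ge], auto)
  finally show "cmod (blinfun_apply (Rep_cdual g) x + z * \<beta>) \<le> C * F (norm x) (cmod z)" .
next
  assume *: "\<forall>x z. cmod (blinfun_apply (Rep_cdual g) x + z * \<beta>) \<le> C * F (norm x) (cmod z)"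
  have "cmod \<beta> \<le> C" using *[rule_format, of 0 1] axis[of 1] by (simp add: blinfun.zero_right)
  then have "0 \<le> C" by (rule order_trans[OF norm_ge_zero])
  show "dual (norm g) (cmod \<beta>) \<le> C"
  proof (rule dual_le)
    fix a b :: real
    assume ab: "0 \<le> a" "0 \<le> b" "F a b \<le> 1"
    have main: "a * cmod (blinfun_apply (Rep_cdual g) x) + cmod \<beta> * b \<le> C" if x: "norm x \<le> 1" for x
    proof -
      let ?w = "blinfun_apply (Rep_cdual g) x"
      have phase: "\<exists>s. cmod s \<le> 1 \<and> s * w = cmod w" for w
      proof (cases "w = 0")
        case False
        have "cnj w / cmod w * w = cmod w"
          using False complex_norm_square[of w] by (simp add: power2_eq_square mult.commute divide_simps)
        then show ?thesis using False by (intro exI[of _ "cnj w / cmod w"]) (simp add: norm_divide)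
      qed (intro exI[of _ 0], simp)
      obtain s where s: "cmod s \<le> 1" "s * ?w = cmod ?w" using phase[of ?w] by blast
      obtain t where t: "cmod t \<le> 1" "t * \<beta> = cmod \<beta>" using phase[of \<beta>] by blast
      have "of_real (a * cmod ?w + cmod \<beta> * b)
          = blinfun_apply (Rep_cdual g) ((a * s) *\<^sub>C x) + (b * t) * \<beta>"
        by (simp add: Rep_cdual_scaleC mult.assoc s t)
      then have "cmod (of_real (a * cmod ?w + cmod \<beta> * b)) \<le> C * F (norm ((a * s) *\<^sub>C x)) (cmod (b * t))"
        using *[rule_format, of "(a * s) *\<^sub>C x" "b * t"] by (simp only:)
      also have "F (norm ((a * s) *\<^sub>C x)) (cmod (b * t)) \<le> F a b"
      proof (rule mono)
        show "norm ((a * s) *\<^sub>C x) \<le> a"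
          using ab mult_le_one[OF s(1) _ x] by (simp add: norm_scaleC norm_mult mult.assoc mult_left_le)
        show "cmod (b * t) \<le> b"
          using ab t by (simp add: norm_mult mult_left_le)
      qed auto
      then have "C * F (norm ((a * s) *\<^sub>C x)) (cmod (b * t)) \<le> C"
        using \<open>0 \<le> C\<close> ab(3) by (simp add: mult_left_le)
      finally show ?thesis by (simp only: norm_of_real abs_le_iff)
    qed
    have b_le: "0 \<le> C - cmod \<beta> * b" using main[of 0] by (simp add: blinfun.zero_right)
    have "norm (a *\<^sub>R Rep_cdual g) \<le> C - cmod \<beta> * b"
    proof (rule norm_blinfun_bound[OF b_le])
      fix x
      show "norm (blinfun_apply (a *\<^sub>R Rep_cdual g) x) \<le> (C - cmod \<beta> * b) * norm x"
      proof (cases "x = 0")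
        case False
        then show ?thesis
          using main[of "x /\<^sub>R norm x"] ab
          by (simp add: blinfun.bilinear_simps field_simps)
      qed (simp add: blinfun.zero_right)
    qed
    then show "norm g * a + cmod \<beta> * b \<le> C"
      using ab by (simp add: norm_cdual_def mult.commute)
  qed
qed

text \<open>Collects what the contradiction draws from a resolvent of norm \<open>M\<close>. The
  vector \<open>y\<close> is only a limit of images of the unit ball, hence the form of
  \<open>approx\<close>. The exponents 1 and 2 give \<open>R y\<close> and \<open>R (R y)\<close>
  for vectors, and the second and third powers of \<open>R\<close> in the dual.\<close>

lemma no_extremal_operator:
  fixes R :: "'y::complex_banach \<times> complex \<Rightarrow> 'y \<times> complex" and y :: "'y \<times> complex"
    and \<psi> :: "real \<Rightarrow> real"
  defines "N \<equiv> psi_sum_norm \<psi>"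
  assumes csc: "complex_strictly_convex TYPE('y)" and cscd: "complex_strictly_convex TYPE('y cdual)"
    and psi: "\<psi> \<in> Psi" and lin: "clinear_on UNIV R" and inj: "\<And>p. R p = 0 \<Longrightarrow> p = 0"
    and dense: "\<And>p e. 0 < e \<Longrightarrow> \<exists>q. N (p - R q) < e"
    and "0 < M" and bound: "\<And>p. N (R p) \<le> M * N p"
    and perturb: "\<And>n. n \<in> {1, 2} \<Longrightarrow>
      \<exists>c>0. \<forall>\<zeta> p. cmod \<zeta> \<le> 1 \<longrightarrow> N (R p + (\<zeta> * of_real c) *\<^sub>C (R ^^ Suc n) p) \<le> M * N p"
    and Ny: "N y = M" and approx: "\<And>e. 0 < e \<Longrightarrow> \<exists>x. N x \<le> 1 \<and> N (R x - y) < e"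
  shows False
proof -
  define F where "F = (\<lambda>a b. psi_norm \<psi> (of_real a, of_real b))"
  interpret F: gauge F unfolding F_def by (rule gauge_psi_norm[OF psi])
  interpret dual: gauge F.dual by (rule F.gauge_dual)
  have N: "N p = F (norm (fst p)) (norm (snd p))" for p
    by (simp add: N_def F_def psi_sum_norm_eq_psi_norm)
  have tri: "N (p + q) \<le> N p + N q" and sc: "N (c *\<^sub>C p) = cmod c * N p" for p q c
    by (simp_all add: N_def psi psi_sum_norm_triangle psi_sum_norm_scaleC)
  have snd_le: "cmod (snd p) \<le> N p" for p
    unfolding N_def by (rule psi_sum_norm_ge(2)[OF psi])
  have N_nonneg: "0 \<le> N p" for p using snd_le[of p] norm_ge_zero order_trans by blast
  note R = clinear_onD[OF lin]
  have Rn_lin: "clinear_on UNIV (R ^^ n)" for n by (rule clinear_on_funpow[OF lin])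
  note Rn = clinear_onD[OF Rn_lin]
  have Rn_bound: "N ((R ^^ n) p) \<le> M ^ n * N p" for n p
  proof (induction n)
    case (Suc n)
    then show ?case
      using order_trans[OF bound mult_left_mono[OF Suc less_imp_le[OF \<open>0 < M\<close>]]]
      by (simp add: mult.assoc)
  qed simp
  have "\<exists>c. \<forall>n\<in>{1, 2}. 0 < c n \<and>
      (\<forall>\<zeta> p. cmod \<zeta> \<le> 1 \<longrightarrow> N (R p + (\<zeta> * of_real (c n)) *\<^sub>C (R ^^ Suc n) p) \<le> M * N p)"
    by (intro bchoice ballI perturb)
  then obtain c where c_pert: "\<forall>n\<in>{1, 2}. 0 < c n \<and>
      (\<forall>\<zeta> p. cmod \<zeta> \<le> 1 \<longrightarrow> N (R p + (\<zeta> * of_real (c n)) *\<^sub>C (R ^^ Suc n) p) \<le> M * N p)" ..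
  have c: "c n > 0" if "n \<in> {1, 2}" for n
    using bspec[OF c_pert that] by (rule conjunct1)
  have pert: "N (R p + (\<zeta> * of_real (c n)) *\<^sub>C (R ^^ Suc n) p) \<le> M * N p"
    if "n \<in> {1, 2}" "cmod \<zeta> \<le> 1" for n \<zeta> p
    using bspec[OF c_pert that(1), THEN conjunct2] that(2) by (simp only:)
  have y_ne: "y \<noteq> 0" using Ny \<open>0 < M\<close> sc[of 0 0] by auto
  have y_pert: "N (y + (\<zeta> * of_real (c n)) *\<^sub>C (R ^^ n) y) \<le> M" if n: "n \<in> {1, 2}" and z: "cmod \<zeta> \<le> 1" for n \<zeta>
  proof (rule field_le_epsilon)
    fix e :: real
    assume "0 < e"
    \<comment> \<open>The error vector \<open>w\<close> enters directly and through the
      \<open>n\<close>-th power of \<open>R\<close>; this choice makes the total error at most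
      \<open>e\<close>.\<close>
    define d where "d = e / (1 + c n * M ^ n)"
    have pos: "1 + c n * M ^ n > 0" using c[OF n] \<open>0 < M\<close> by (simp add: add_pos_pos)
    then have "0 < d" using \<open>0 < e\<close> by (simp add: d_def)
    then obtain x where x: "N x \<le> 1" "N (R x - y) < d" using approx by blast
    define w where "w = y - R x"
    have "N w = N (R x - y)" using sc[of "-1" "R x - y"] by (simp add: w_def)
    then have w: "N w \<le> d" using x by simp
    have "y + (\<zeta> * of_real (c n)) *\<^sub>C (R ^^ n) y = (R x + (\<zeta> * of_real (c n)) *\<^sub>C (R ^^ Suc n) x)
        + (w + (\<zeta> * of_real (c n)) *\<^sub>C (R ^^ n) w)"
      by (simp add: w_def Rn cvs.scale_right_diff_distrib funpow_swap1)
    then have "N (y + (\<zeta> * of_real (c n)) *\<^sub>C (R ^^ n) y)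
        \<le> N (R x + (\<zeta> * of_real (c n)) *\<^sub>C (R ^^ Suc n) x) + (N w + N ((\<zeta> * of_real (c n)) *\<^sub>C (R ^^ n) w))"
      by (simp only: order_trans[OF tri add_left_mono[OF tri]])
    also have "N (R x + (\<zeta> * of_real (c n)) *\<^sub>C (R ^^ Suc n) x) \<le> M"
      using pert[OF n z, of x] x(1) \<open>0 < M\<close> by (simp add: mult_left_le order_trans)
    also have "N ((\<zeta> * of_real (c n)) *\<^sub>C (R ^^ n) w) = cmod \<zeta> * (c n * N ((R ^^ n) w))"
      using c[OF n] by (simp add: sc norm_mult)
    also have "\<dots> \<le> 1 * (c n * (M ^ n * d))"
      using z c[OF n] Rn_bound[of n w] w \<open>0 < M\<close> N_nonneg
      by (intro mult_mono mult_left_mono) (auto intro!: order_trans[OF Rn_bound] mult_left_mono)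
    also note w
    also have "M + (d + 1 * (c n * (M ^ n * d))) = M + d * (1 + c n * M ^ n)"
      by (simp add: algebra_simps)
    also have "\<dots> = M + e" using pos by (simp add: d_def)
    finally show "N (y + (\<zeta> * of_real (c n)) *\<^sub>C (R ^^ n) y) \<le> M + e" by simp
  qed
  \<comment> \<open>Otherwise \<open>R y\<close> and \<open>R (R y)\<close> have zero first
    component and are proportional, so \<open>R\<close> annihilates a combination of
    \<open>R y\<close> and \<open>y\<close>. Injectivity makes that combination zero and its
    coefficient \<open>s2\<close> nonzero; hence \<open>fst y = 0\<close>, where the gauge is the
    modulus of the second component.\<close>
  have v: "cmod (snd y) = M"
  proof (rule ccontr)
    assume "cmod (snd y) \<noteq> M"
    then have ne: "F (norm (fst y)) (cmod (snd y)) \<noteq> cmod (snd y)"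
      using Ny by (simp add: N)
    have fst0: "fst ((R ^^ n) y) = 0" if n: "n \<in> {1, 2}" for n
    proof -
      have "of_real (c n) *\<^sub>C fst ((R ^^ n) y) = 0"
      proof (rule F.complex_extreme(1)[OF csc _ ne])
        show "F (norm (fst y + \<zeta> *\<^sub>C of_real (c n) *\<^sub>C fst ((R ^^ n) y)))
            (norm (snd y + \<zeta> * (of_real (c n) * snd ((R ^^ n) y)))) \<le> F (norm (fst y)) (norm (snd y))"
          if "cmod \<zeta> \<le> 1" for \<zeta>
          using y_pert[OF n that] Ny by (simp add: N scaleC_scaleC scaleC_complex_def mult.assoc)
      qed
      then show ?thesis using c[OF n] by simp
    qed
    define s1 where "s1 = snd (R y)"
    define s2 where "s2 = snd (R (R y))"
    have Ry: "R y = (0, s1)" using fst0[of 1] by (simp add: s1_def prod_eq_iff)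
    have RRy: "R (R y) = (0, s2)" using fst0[of 2] by (simp add: s2_def prod_eq_iff numeral_2_eq_2)
    have "R (s1 *\<^sub>C R y - s2 *\<^sub>C y) = s1 *\<^sub>C (0, s2) - s2 *\<^sub>C (0, s1)"
      by (simp only: R RRy) (simp only: Ry)
    also have "\<dots> = 0"
      by (simp add: prod_eq_iff scaleC_complex_def)
    finally have "s1 *\<^sub>C R y - s2 *\<^sub>C y = 0" by (rule inj)
    then have "fst (s1 *\<^sub>C R y) = fst (s2 *\<^sub>C y)" by simp
    then have "s2 *\<^sub>C fst y = 0" using Ry by simp
    moreover have "s2 \<noteq> 0" using RRy inj y_ne by (metis zero_prod_def)
    ultimately have "fst y = 0" by simp
    then show False using ne F.axis by simp
  qed
  \<comment> \<open>The coordinate functional after \<open>n\<close> applications of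
    \<open>R\<close>; the pair \<open>(g n, \<beta> n)\<close> represents it in the dual.\<close>
  define h where "h n = (\<lambda>p. snd ((R ^^ n) p))" for n
  have h_lin: "clinear_on UNIV (h n)" for n
    by (simp add: clinear_on_UNIV_iff h_def Rn)
  have "\<exists>g. \<forall>x z. h n (x, z) = blinfun_apply (Rep_cdual g) x + z * h n (0, 1)" for n
  proof -
    have "cmod (h n (x, 0)) \<le> M ^ n * norm x" for x
      using order_trans[OF snd_le Rn_bound[of n "(x, 0)"]] F.axis' by (simp add: h_def N)
    then show ?thesis by (rule functional_on_sum_rep[OF h_lin]) blast
  qed
  then have "\<exists>g. \<forall>n x z. h n (x, z) = blinfun_apply (Rep_cdual (g n)) x + z * h n (0, 1)"
    by (intro choice allI)
  then obtain g where g: "h n (x, z) = blinfun_apply (Rep_cdual (g n)) x + z * h n (0, 1)" for n x z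
    by blast
  define \<beta> where "\<beta> n = h n (0, 1)" for n
  have h: "h n p = blinfun_apply (Rep_cdual (g n)) (fst p) + snd p * \<beta> n" for n p
    using g[of n "fst p" "snd p"] by (simp add: \<beta>_def)
  have h_approx: "\<exists>x. N x \<le> 1 \<and> M - e < cmod (h 1 x)" if "0 < e" for e
  proof -
    obtain x where x: "N x \<le> 1" "N (R x - y) < e" using approx[OF \<open>0 < e\<close>] by blast
    have "M - cmod (snd (R x)) \<le> cmod (snd (R x - y))"
      using v norm_triangle_ineq3[of "snd (R x)" "snd y"] by simp
    then show ?thesis using x snd_le[of "R x - y"] by (intro exI[of _ x]) (simp add: h_def)
  qed
  \<comment> \<open>The functional \<open>h 1\<close> has norm exactly \<open>M\<close>, since on
    the unit ball its modulus comes arbitrarily close to \<open>cmod (snd y) = M\<close>.\<close>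
  have dual_eq: "F.dual (norm (g 1)) (cmod (\<beta> 1)) = M"
  proof (rule antisym)
    show "F.dual (norm (g 1)) (cmod (\<beta> 1)) \<le> M"
      unfolding F.dual_norm_le_iff
    proof (intro allI)
      fix x z
      show "cmod (blinfun_apply (Rep_cdual (g 1)) x + z * \<beta> 1) \<le> M * F (norm x) (cmod z)"
        using h[of 1 "(x, z)"] order_trans[OF snd_le bound[of "(x, z)"]] by (simp add: h_def N)
    qed
    show "M \<le> F.dual (norm (g 1)) (cmod (\<beta> 1))"
    proof (rule field_le_epsilon)
      fix e :: real assume "0 < e"
      then obtain x where x: "N x \<le> 1" "M - e < cmod (h 1 x)" using h_approx by blast
      have "cmod (h 1 x) \<le> F.dual (norm (g 1)) (cmod (\<beta> 1)) * N x"
        using F.dual_norm_le_iff[of "g 1" "\<beta> 1" "F.dual (norm (g 1)) (cmod (\<beta> 1))"] by (simp add: h N)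
      also have "\<dots> \<le> F.dual (norm (g 1)) (cmod (\<beta> 1))"
        using x dual.ge[of "norm (g 1)" "cmod (\<beta> 1)"]
        by (intro mult_left_le) (auto intro: order_trans[OF norm_ge_zero])
      finally show "M \<le> F.dual (norm (g 1)) (cmod (\<beta> 1)) + e" using x by simp
    qed
  qed
  \<comment> \<open>The second coordinate is a functional of norm at most 1, so composing it with
    the perturbed operator carries the extremality over to the dual, with \<open>h (Suc n)\<close>
    as the direction.\<close>
  have dual_pert: "F.dual (norm (g 1 + \<zeta> *\<^sub>C of_real (c n) *\<^sub>C g (Suc n)))
      (cmod (\<beta> 1 + \<zeta> * (of_real (c n) * \<beta> (Suc n)))) \<le> F.dual (norm (g 1)) (cmod (\<beta> 1))"
    if n: "n \<in> {1, 2}" and z: "cmod \<zeta> \<le> 1" for n \<zeta>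
    unfolding dual_eq F.dual_norm_le_iff
  proof (intro allI)
    fix x :: 'y and z :: complex
    let ?p = "(x, z)"
    have "blinfun_apply (Rep_cdual (g 1 + \<zeta> *\<^sub>C of_real (c n) *\<^sub>C g (Suc n))) x
        + z * (\<beta> 1 + \<zeta> * (of_real (c n) * \<beta> (Suc n))) = h 1 ?p + (\<zeta> * of_real (c n)) * h (Suc n) ?p"
      by (simp add: h Rep_cdual_simps blinfun.add_left algebra_simps)
    also have "\<dots> = snd (R ?p + (\<zeta> * of_real (c n)) *\<^sub>C (R ^^ Suc n) ?p)"
      by (simp add: h_def scaleC_complex_def)
    also have "cmod \<dots> \<le> M * N ?p"
      by (rule order_trans[OF snd_le pert[OF n z]])
    finally show "cmod (blinfun_apply (Rep_cdual (g 1 + \<zeta> *\<^sub>C of_real (c n) *\<^sub>C g (Suc n))) x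
        + z * (\<beta> 1 + \<zeta> * (of_real (c n) * \<beta> (Suc n)))) \<le> M * F (norm x) (cmod z)"
      by (simp add: N)
  qed
  \<comment> \<open>Otherwise \<open>g 2 = g 3 = 0\<close>. Evaluating the third power of
    \<open>R\<close> at \<open>(x, 0)\<close> in two ways gives
    \<open>\<beta> 2 * snd (R (x, 0)) = 0\<close>, so \<open>g 1 = 0\<close>, and then the dual
    gauge is \<open>cmod (\<beta> 1)\<close> after all.\<close>
  have \<beta>1: "cmod (\<beta> 1) = M"
  proof (rule ccontr)
    assume "cmod (\<beta> 1) \<noteq> M"
    then have ne: "F.dual (norm (g 1)) (cmod (\<beta> 1)) \<noteq> cmod (\<beta> 1)" using dual_eq by simp
    have g0: "g (Suc n) = 0" if n: "n \<in> {1, 2}" for n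
    proof -
      have "of_real (c n) *\<^sub>C g (Suc n) = 0"
        using dual.complex_extreme(1)[OF cscd dual_pert[OF n] ne] .
      then show ?thesis using c[OF n] by simp
    qed
    have h2: "snd (R (R p)) = snd p * \<beta> 2" and h3: "snd (R (R (R p))) = snd p * \<beta> 3" for p
      using g0[of 1] g0[of 2] h[of 2 p] h[of 3 p]
      by (simp_all add: h_def Rep_cdual_simps numeral_2_eq_2 numeral_3_eq_3)
    have "\<beta> 2 \<noteq> 0"
    proof
      assume "\<beta> 2 = 0"
      \<comment> \<open>If \<open>\<beta> 2 = 0\<close>, the functional \<open>h 1\<close> vanishes
        on the range of \<open>R\<close>; as this is dense, it vanishes everywhere, although its
        norm is \<open>M\<close>.\<close>
      have "snd (R p) = 0" for p
      proof -
        have "cmod (snd (R p)) \<le> 0 + e" if "0 < e" for e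
        proof -
          obtain q where q: "N (p - R q) < e / M" using dense[OF divide_pos_pos[OF \<open>0 < e\<close> \<open>0 < M\<close>]] by blast
          have "cmod (snd (R p)) = cmod (snd (R (p - R q)))"
            using h2[of q] \<open>\<beta> 2 = 0\<close> by (simp add: R)
          also have "\<dots> \<le> M * N (p - R q)" by (rule order_trans[OF snd_le bound])
          also have "\<dots> \<le> e" using q \<open>0 < M\<close> by (simp add: field_simps)
          finally show ?thesis by simp
        qed
        then have "cmod (snd (R p)) \<le> 0" by (rule field_le_epsilon)
        then show ?thesis by simp
      qed
      then show False using h_approx[of M] \<open>0 < M\<close> by (simp add: h_def)
    qed
    then have "h 1 (x, 0) = 0" for x
      using h2[of "R (x, 0)"] h3[of "(x, 0)"] by (simp add: h_def)
    then have "blinfun_apply (Rep_cdual (g 1)) x = 0" for x using h[of 1 "(x, 0)"] by simp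
    then have "Rep_cdual (g 1) = 0" by (intro blinfun_eqI) simp
    then have "norm (g 1) = 0" by (simp add: norm_cdual_def)
    then show False using ne dual.axis by simp
  qed
  \<comment> \<open>The dual gauge now equals the modulus \<open>cmod (\<beta> 1)\<close>, so the
    scalar component of the perturbation has to vanish.\<close>
  have "of_real (c 1) * \<beta> (Suc 1) = 0"
    using dual.complex_extreme(2)[OF cscd dual_pert[of 1]] \<beta>1 dual_eq by simp
  then have \<beta>2: "\<beta> 2 = 0" using c[of 1] by (simp add: numeral_2_eq_2)
  define e :: "'y \<times> complex" where "e = (0, 1)"
  have v1: "snd (R e) = \<beta> 1" and v2: "snd (R (R e)) = 0"
    using \<beta>2 by (simp_all add: \<beta>_def h_def e_def numeral_2_eq_2)
  have \<beta>1_ne: "\<beta> 1 \<noteq> 0" using \<beta>1 \<open>0 < M\<close> by auto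
  \<comment> \<open>Its second component is that of \<open>R e\<close> divided by
    \<open>\<beta> 1\<close>, its first the negative; the two norms agree. In
    \<open>snd (R p)\<close> the contribution of \<open>R (R e)\<close> drops out because
    \<open>\<beta> 2 = 0\<close>.\<close>
  define p where "p = 2 *\<^sub>C e - inverse (\<beta> 1) *\<^sub>C R e"
  have "N p = F (norm (fst (inverse (\<beta> 1) *\<^sub>C R e))) (norm (snd (inverse (\<beta> 1) *\<^sub>C R e)))"
    using v1 \<beta>1_ne by (simp add: N p_def e_def scaleC_complex_def)
  also have "\<dots> = N (R e) / M"
    unfolding N[symmetric] sc norm_inverse \<beta>1 by (simp add: divide_inverse mult.commute)
  also have "\<dots> \<le> 1"
    using bound[of e] F.axis[of 1] \<open>0 < M\<close> by (simp add: N e_def)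
  finally have "N p \<le> 1" .
  have "snd (R p) = 2 * \<beta> 1"
    unfolding p_def R using v1 v2 by (simp add: scaleC_complex_def)
  then have "2 * M \<le> N (R p)" using snd_le[of "R p"] \<beta>1 by (simp add: norm_mult)
  also have "\<dots> \<le> M" using bound[of p] \<open>N p \<le> 1\<close> \<open>0 < M\<close> by (simp add: mult_left_le order_trans)
  finally show False using \<open>0 < M\<close> by simp
qed


section \<open>Resolvents\<close>

text \<open>The Neumann coefficient at index \<open>k\<close> is \<open>(S 0 ^^ Suc k) p\<close>. As
  \<open>r * M \<le> 1 / 2\<close>, the remainder and the aliasing term in
  \<open>Fejer_average\<close> with \<open>K = n + j\<close> decay like \<open>(1 / 2) ^ j\<close>,
  and letting \<open>j\<close> grow leaves the bound. The constant combines the Fourier coefficient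
  1/2 of the kernel with \<open>r ^ n\<close>.\<close>

lemma resolvent_perturbation:
  fixes N :: "'v::complex_vector \<Rightarrow> real" and S :: "complex \<Rightarrow> 'v \<Rightarrow> 'v"
  assumes tri: "\<And>p q. N (p + q) \<le> N p + N q" and sc: "\<And>c p. N (c *\<^sub>C p) = cmod c * N p"
    and bound: "\<And>z p. cmod z \<le> r \<Longrightarrow> N (S z p) \<le> M * N p"
    and step: "\<And>z p. cmod z \<le> r \<Longrightarrow> S z p = S 0 p + z *\<^sub>C S z (S 0 p)"
    and r: "0 < r" "r * M \<le> 1 / 2" and "0 < M" and n: "0 < n" and z: "cmod \<zeta> \<le> 1"
  shows "N (S 0 p + (\<zeta> * of_real (r ^ n / 2)) *\<^sub>C (S 0 ^^ Suc n) p) \<le> M * N p"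
proof -
  have N_nonneg: "0 \<le> N q" for q
    using tri[of q "(-1) *\<^sub>C q"] sc[of "-1" q] sc[of 0 0] by simp
  have pow: "N ((S 0 ^^ k) p) \<le> M ^ k * N p" for k
  proof (induction k)
    case (Suc k)
    then show ?case
      using order_trans[OF bound[of 0] mult_left_mono[OF Suc less_imp_le[OF \<open>0 < M\<close>]]] r
      by (simp add: mult.assoc)
  qed simp
  \<comment> \<open>Iterating the resolvent identity yields the Neumann series with an exact
    remainder.\<close>
  have expand: "S z p = (\<Sum>k<K. z ^ k *\<^sub>C (S 0 ^^ Suc k) p) + z ^ K *\<^sub>C S z ((S 0 ^^ K) p)"
    if "cmod z \<le> r" for z K
  proof (induction K)
    case (Suc K)
    have "S z ((S 0 ^^ K) p) = (S 0 ^^ Suc K) p + z *\<^sub>C S z ((S 0 ^^ Suc K) p)"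
      using step[OF that, of "(S 0 ^^ K) p"] by simp
    then show ?case
      using Suc by (simp add: scaleC_add_right scaleC_scaleC mult.commute add.assoc)
  qed simp
  have small: "M ^ k * r ^ k \<le> (1 / 2) ^ k" for k
    using r \<open>0 < M\<close> power_mono[of "M * r" "1 / 2" k] by (simp add: power_mult_distrib mult.commute)
  have main: "N (S 0 p + (\<zeta> / 2 * r ^ n) *\<^sub>C (S 0 ^^ Suc n) p) \<le> M * N p + 2 * M * N p * (1 / 2) ^ j"
    if j: "n < j" for j
  proof -
    let ?K = "n + j"
    have "N ((S 0 ^^ Suc 0) p + (\<zeta> / 2 * r ^ n) *\<^sub>C (S 0 ^^ Suc n) p)
        \<le> M * N p + M * N p * (1 / 2) ^ j + r ^ (?K - n) * N ((S 0 ^^ Suc (?K - n)) p)"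
    proof (rule Fejer_average[OF tri sc, where f = "\<lambda>z. S z p"])
      fix z :: complex assume zr: "cmod z = r"
      show "N (S z p) \<le> M * N p" by (rule bound) (simp add: zr)
      have "N (S z p - (\<Sum>k<?K. z ^ k *\<^sub>C (S 0 ^^ Suc k) p)) = r ^ ?K * N (S z ((S 0 ^^ ?K) p))"
        using expand[of z ?K] zr by (simp add: sc norm_power)
      also have "\<dots> \<le> r ^ ?K * (M * (M ^ ?K * N p))"
        using zr r \<open>0 < M\<close> pow[of ?K]
        by (intro mult_left_mono order_trans[OF bound]) auto
      also have "\<dots> = M * N p * (M ^ ?K * r ^ ?K)" by simp
      also have "\<dots> \<le> M * N p * (1 / 2) ^ j"
      proof (rule mult_left_mono)
        have "(1 / 2 :: real) ^ ?K \<le> (1 / 2) ^ j" by (rule power_decreasing) auto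
        with small[of ?K] show "M ^ ?K * r ^ ?K \<le> (1 / 2) ^ j" by (rule order_trans)
      qed (use \<open>0 < M\<close> N_nonneg in simp)
      finally show "N (S z p - (\<Sum>k<?K. z ^ k *\<^sub>C (S 0 ^^ Suc k) p)) \<le> M * N p * (1 / 2) ^ j" .
    qed (use n j z r in auto)
    moreover have "r ^ j * N ((S 0 ^^ Suc j) p) \<le> M * N p * (1 / 2) ^ j"
    proof -
      have "r ^ j * N ((S 0 ^^ Suc j) p) \<le> r ^ j * (M ^ Suc j * N p)"
        using r by (intro mult_left_mono pow) auto
      also have "\<dots> = M * N p * (M ^ j * r ^ j)" by simp
      also have "\<dots> \<le> M * N p * (1 / 2) ^ j"
        using \<open>0 < M\<close> N_nonneg by (intro mult_left_mono small) simp
      finally show ?thesis .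
    qed
    ultimately show ?thesis by simp
  qed
  have "(\<lambda>j. M * N p + 2 * M * N p * (1 / 2) ^ j) \<longlonglongrightarrow> M * N p + 2 * M * N p * 0"
    by (intro tendsto_intros LIMSEQ_power_zero) simp
  then have "N (S 0 p + (\<zeta> / 2 * r ^ n) *\<^sub>C (S 0 ^^ Suc n) p) \<le> M * N p + 2 * M * N p * 0"
    by (rule LIMSEQ_le_const) (use main in \<open>auto intro!: exI[of _ "Suc n"]\<close>)
  then show ?thesis by simp
qed

section \<open>The operator norm as a supremum\<close>

lemma op_norm_bdd_above:
  fixes N :: "'v::complex_vector \<Rightarrow> real"
  assumes nonneg: "\<And>p. 0 \<le> N p" and bound: "\<And>p. N (f p) \<le> C * N p"
  shows "bdd_above (range (\<lambda>p. N (f p) / N p))"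
proof (rule bdd_aboveI2)
  \<comment> \<open>The maximum with 0 covers \<open>N p = 0\<close>, where the quotient is
    0.\<close>
  show "N (f p) / N p \<le> max C 0" for p
    using bound[of p] nonneg[of p] by (cases "N p = 0") (auto simp: divide_le_eq le_max_iff_disj)
qed

lemma op_norm_ge:
  fixes N :: "'v::complex_vector \<Rightarrow> real"
  assumes nonneg: "\<And>p. 0 \<le> N p" and bound: "\<And>p. N (f p) \<le> C * N p"
  shows "N (f p) \<le> op_norm N f * N p"
proof (cases "N p = 0")
  case True
  then show ?thesis using bound[of p] by simp
next
  case False
  then have pos: "0 < N p" using nonneg[of p] by simp
  note op_norm_bdd_above[of N f, OF nonneg bound]
  then have "N (f p) / N p \<le> op_norm N f" unfolding op_norm_def by (rule cSUP_upper[rotated]) simp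
  then show ?thesis using pos by (simp add: divide_le_eq)
qed

lemma op_norm_approx:
  fixes N :: "'v::complex_vector \<Rightarrow> real"
  assumes nonneg: "\<And>p. 0 \<le> N p" and bound: "\<And>p. N (f p) \<le> C * N p" and "c < op_norm N f"
  obtains x where "c < N (f x) / N x"
proof -
  note op_norm_bdd_above[of N f, OF nonneg bound]
  then show ?thesis
    using assms(3) that unfolding op_norm_def by (subst (asm) less_cSUP_iff) auto
qed

theorem theorem3p2:
  fixes \<Omega> :: "complex set"
    and \<psi> :: "real \<Rightarrow> real"
    and D :: "('y::complex_banach \<times> complex) set"
    and A :: "'y \<times> complex \<Rightarrow> 'y \<times> complex"
    and M :: real
  assumes "open \<Omega>"
    and "complex_strictly_convex TYPE('y)"
    and "complex_strictly_convex TYPE('y cdual)"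
    and "\<psi> \<in> Psi"
    and "clinear_on D A"
    and "densely_defined (psi_sum_norm \<psi>) D"
    and "closed_operator (psi_sum_norm \<psi>) D A"
    and "\<Omega> \<subseteq> resolvent_set (psi_sum_norm \<psi>) D A"
    and "\<forall>\<mu>\<in>resolvent_set (psi_sum_norm \<psi>) D A. compact_operator (psi_sum_norm \<psi>) (resolvent D A \<mu>)"
    and "\<forall>\<mu>\<in>\<Omega>. op_norm (psi_sum_norm \<psi>) (resolvent D A \<mu>) \<le> M"
  shows "\<forall>\<mu>\<in>\<Omega>. op_norm (psi_sum_norm \<psi>) (resolvent D A \<mu>) < M"
proof (rule ballI, rule ccontr)
  fix \<mu>
  assume \<mu>: "\<mu> \<in> \<Omega>"
  define N where "N = (psi_sum_norm \<psi> :: 'y \<times> complex \<Rightarrow> real)"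
  note psi = \<open>\<psi> \<in> Psi\<close>
  assume "\<not> op_norm (psi_sum_norm \<psi>) (resolvent D A \<mu>) < M"
  then have op_M: "op_norm N (resolvent D A \<mu>) = M"
    using assms(10) \<mu> by (force simp: N_def)
  have tri: "N (p + q) \<le> N p + N q" and sc: "N (c *\<^sub>C p) = cmod c * N p"
    and zero_iff: "N p = 0 \<longleftrightarrow> p = 0" for p q c
    by (simp_all add: N_def psi psi_sum_norm_triangle psi_sum_norm_scaleC psi_sum_norm_eq_0_iff)
  have N_nonneg: "0 \<le> N p" for p
    using psi_sum_norm_ge(1)[OF psi, of p] norm_ge_zero order_trans unfolding N_def by blast
  interpret Metric_space UNIV "\<lambda>p q. N (p - q)"
    unfolding N_def by (rule Metric_space_psi_sum_norm[OF psi])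
  have topo: "norm_topology N = mtopology" by (simp add: norm_topology_def)
  define S where "S z = resolvent D A (\<mu> + z)" for z
  define R where "R = S 0"
  have mem: "\<mu> + z \<in> resolvent_set N D A" if "\<mu> + z \<in> \<Omega>" for z
    using that assms(8) by (auto simp: N_def)
  have bij: "bij_betw (\<lambda>x. A x - (\<mu> + z) *\<^sub>C x) D UNIV" if "\<mu> + z \<in> \<Omega>" for z
    using mem[OF that] by (simp add: resolvent_set_def)
  have S_mem: "S z p \<in> D" and S_eq: "A (S z p) - (\<mu> + z) *\<^sub>C S z p = p" if "\<mu> + z \<in> \<Omega>" for z p
    using bij_betw_imp_surj_on[OF bij[OF that]]
    by (auto simp: S_def resolvent_def intro!: inv_into_into f_inv_into_f[of p "\<lambda>x. A x - (\<mu> + z) *\<^sub>C x" D])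
  have S_inv: "S z (A x - (\<mu> + z) *\<^sub>C x) = x" if "\<mu> + z \<in> \<Omega>" "x \<in> D" for z x
    unfolding S_def resolvent_def
    using inv_into_f_f[OF bij_betw_imp_inj_on[OF bij[OF that(1)]] that(2)] .
  have S_compact: "compact_operator N (S z)" if "\<mu> + z \<in> \<Omega>" for z
    using assms(9) mem[OF that] by (simp add: N_def S_def)
  then have S_lin: "clinear_on UNIV (S z)" if "\<mu> + z \<in> \<Omega>" for z
    using that by (simp add: compact_operator_def)
  have S_bdd: "\<exists>C. \<forall>p. N (S z p) \<le> C * N p" if "\<mu> + z \<in> \<Omega>" for z
    using mem[OF that] by (simp add: resolvent_set_def S_def)
  have S_bound: "N (S z p) \<le> M * N p" if z: "\<mu> + z \<in> \<Omega>" for z p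
  proof -
    obtain C where C: "\<And>p. N (S z p) \<le> C * N p" using S_bdd[OF z] by blast
    have "N (S z p) \<le> op_norm N (S z) * N p" by (rule op_norm_ge[of N, OF N_nonneg C])
    also have "\<dots> \<le> M * N p"
      using assms(10) z by (intro mult_right_mono N_nonneg) (auto simp: N_def S_def)
    finally show ?thesis .
  qed
  have \<mu>0: "\<mu> + 0 \<in> \<Omega>" using \<mu> by simp
  \<comment> \<open>The first resolvent identity, obtained by applying \<open>S z\<close> to the
    image of \<open>R p\<close> under the operator shifted by \<open>\<mu> + z\<close>.\<close>
  have S_step: "S z p = R p + z *\<^sub>C S z (R p)" if z: "\<mu> + z \<in> \<Omega>" for z p
  proof -
    have "A (R p) - (\<mu> + z) *\<^sub>C R p = p - z *\<^sub>C R p"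
      using S_eq[OF \<mu>0, of p] by (simp add: R_def scaleC_add_left algebra_simps)
    then have "R p = S z (p - z *\<^sub>C R p)"
      using S_inv[OF z S_mem[OF \<mu>0], of p] by (simp add: R_def)
    then show ?thesis
      using clinear_onD[OF S_lin[OF z]] by (simp add: algebra_simps)
  qed
  have "A (0 *\<^sub>C 0) = 0 *\<^sub>C A 0" using assms(5) unfolding clinear_on_def csubspace_def by blast
  then have A0: "A 0 = 0" by simp
  have inj: "p = 0" if "R p = 0" for p
    using S_eq[OF \<mu>0, of p] that A0 by (simp add: R_def)
  have R_bound: "N (R p) \<le> M * N p" for p unfolding R_def by (rule S_bound[OF \<mu>0])
  have "0 < M"
  proof (rule ccontr)
    assume "\<not> 0 < M"
    then have "N (R (0, 1)) \<le> 0"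
      using R_bound[of "(0, 1)"] N_nonneg[of "(0, 1)"] mult_nonpos_nonneg[of M "N (0, 1)"] by linarith
    then have "R (0, 1) = 0" using N_nonneg[of "R (0, 1)"] zero_iff[of "R (0, 1)"] by simp
    then have "(0 :: 'y, 1 :: complex) = 0" by (rule inj)
    then show False by (simp add: prod_eq_iff)
  qed
  \<comment> \<open>The range of \<open>R\<close> contains the dense domain
    \<open>D\<close>.\<close>
  have dense: "\<exists>q. N (p - R q) < e" if "0 < e" for p e
  proof -
    have "p \<in> mtopology closure_of D"
      using assms(6) by (simp add: densely_defined_def topo flip: N_def)
    then obtain d where d: "d \<in> D" "N (p - d) < e"
      using \<open>0 < e\<close> by (auto simp: metric_closure_of)
    have "R (A d - (\<mu> + 0) *\<^sub>C d) = d"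
      unfolding R_def by (rule S_inv[OF \<mu>0 d(1)])
    with d(2) show ?thesis
      by (intro exI[of _ "A d - (\<mu> + 0) *\<^sub>C d"]) (simp only:)
  qed
  obtain r0 where r0: "0 < r0" "cball \<mu> r0 \<subseteq> \<Omega>"
    using \<open>open \<Omega>\<close>[unfolded open_contains_cball] \<mu> by (auto simp only: Ball_def)
  \<comment> \<open>Small enough for the disc to stay in \<Omega> and for the Neumann series to have
    ratio at most 1/2.\<close>
  define r where "r = min r0 (1 / (2 * M))"
  have r: "0 < r" "r * M \<le> 1 / 2" "r \<le> r0"
  proof -
    have "r * M \<le> 1 / (2 * M) * M" using \<open>0 < M\<close> by (intro mult_right_mono) (auto simp: r_def)
    then show "r * M \<le> 1 / 2" using \<open>0 < M\<close> by simp
  qed (use r0 \<open>0 < M\<close> in \<open>auto simp: r_def\<close>)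
  have in_\<Omega>: "\<mu> + z \<in> \<Omega>" if "cmod z \<le> r" for z
    using that r r0 by (auto simp: dist_norm)
  have perturb: "\<exists>c>0. \<forall>\<zeta> p. cmod \<zeta> \<le> 1 \<longrightarrow> N (R p + (\<zeta> * of_real c) *\<^sub>C (R ^^ Suc n) p) \<le> M * N p"
    if "n \<in> {1, 2}" for n :: nat
  proof (intro exI[of _ "r ^ n / 2"] conjI allI impI)
    fix \<zeta> :: complex and p
    assume z: "cmod \<zeta> \<le> 1"
    have step: "S z p = S 0 p + z *\<^sub>C S z (S 0 p)" if "cmod z \<le> r" for z p
      using S_step[OF in_\<Omega>[OF that]] unfolding R_def .
    show "N (R p + (\<zeta> * of_real (r ^ n / 2)) *\<^sub>C (R ^^ Suc n) p) \<le> M * N p"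
      unfolding R_def
      by (rule resolvent_perturbation[where S = S and N = N, OF tri sc S_bound[OF in_\<Omega>] step
            r(1,2) \<open>0 < M\<close> _ z]) (use that in auto)
  qed (use r in simp)
  \<comment> \<open>The condition \<open>e \<le> M\<close> keeps \<open>M - e\<close> nonnegative,
    which excludes vectors with \<open>N x = 0\<close>, whose quotient is 0; the others can be
    normalised.\<close>
  have approx: "\<exists>x. N x \<le> 1 \<and> M - e < N (R x)" if e: "0 < e" "e \<le> M" for e
  proof -
    obtain C where C: "\<And>p. N (R p) \<le> C * N p" using S_bdd[OF \<mu>0] by (auto simp: R_def)
    obtain x where x: "M - e < N (R x) / N x"
      by (rule op_norm_approx[of N R, OF N_nonneg C, of "M - e"]) (use op_M e in \<open>auto simp: R_def S_def\<close>)
    then have "N x \<noteq> 0" using e by auto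
    then have "0 < N x" using N_nonneg[of x] by simp
    then have "N (of_real (inverse (N x)) *\<^sub>C x) = 1"
        "N (R (of_real (inverse (N x)) *\<^sub>C x)) = N (R x) / N x"
      using clinear_onD(2)[OF S_lin[OF \<mu>0]] by (simp_all add: R_def sc norm_inverse divide_inverse mult.commute)
    then show ?thesis
      using x by (intro exI[of _ "of_real (inverse (N x)) *\<^sub>C x"]) (simp only: order_refl simp_thms)
  qed
  have "\<exists>x. \<forall>k. N (x k) \<le> 1 \<and> M - M / Suc k < N (R (x k))"
    using \<open>0 < M\<close> by (intro choice allI approx) (simp_all add: divide_le_eq)
  then obtain x where x: "N (x k) \<le> 1" "M - M / Suc k < N (R (x k))" for k by blast
  define \<sigma> where "\<sigma> k = R (x k)" for k
  let ?K = "mtopology closure_of (R ` {x. N x \<le> 1})"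
  have "compactin mtopology ?K"
    using S_compact[OF \<mu>0] by (simp add: compact_operator_def R_def topo)
  moreover have "range \<sigma> \<subseteq> ?K"
    using x(1) closure_of_subset[of "R ` {x. N x \<le> 1}" mtopology] by (auto simp: \<sigma>_def)
  \<comment> \<open>Compactness enters here: the images of a maximising sequence have a convergent
    subsequence, whose limit has norm \<open>M\<close>.\<close>
  ultimately obtain y s where s: "strict_mono s" and lim: "limitin mtopology (\<sigma> \<circ> s) y sequentially"
    unfolding compactin_sequentially by blast
  have near: "\<exists>k0. \<forall>k\<ge>k0. N (R (x (s k)) - y) < e" if "0 < e" for e
    using lim that by (simp add: limitin_metric eventually_sequentially \<sigma>_def)
  have Ny: "N y = M"
  proof (rule antisym)
    have diff: "N p \<le> N q + N (p - q)" for p q using tri[of q "p - q"] by simp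
    show "N y \<le> M"
    proof (rule field_le_epsilon)
      fix e :: real assume "0 < e"
      then obtain k where k: "N (R (x (s k)) - y) < e" using near by blast
      have "N (y - R (x (s k))) = N (R (x (s k)) - y)" by (rule commute)
      moreover have "N (R (x (s k))) \<le> M"
        using R_bound[of "x (s k)"] x(1)[of "s k"] \<open>0 < M\<close> by (simp add: mult_left_le order_trans)
      ultimately show "N y \<le> M + e" using k diff[of y "R (x (s k))"] by simp
    qed
    show "M \<le> N y"
    proof (rule field_le_epsilon)
      fix e :: real assume "0 < e"
      then obtain k0 where k0: "\<And>k. k0 \<le> k \<Longrightarrow> N (R (x (s k)) - y) < e / 2"
        using near[of "e / 2"] by auto
      obtain k1 :: nat where k1: "M / (e / 2) < k1" using reals_Archimedean2 by blast
      define k where "k = max k0 k1"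
      have "k1 \<le> s k" using seq_suble[OF s, of k] by (simp add: k_def)
      then have "M / (e / 2) < Suc (s k)" using k1 by linarith
      then have "M / Suc (s k) < e / 2" using \<open>0 < e\<close> by (simp add: field_simps)
      then show "M \<le> N y + e"
        using x(2)[of "s k"] k0[of k] diff[of "R (x (s k))" y] by (simp add: k_def)
    qed
  qed
  show False
  proof (rule no_extremal_operator[OF assms(2,3,4)])
    show "clinear_on UNIV R" unfolding R_def by (rule S_lin[OF \<mu>0])
    show "\<exists>x. psi_sum_norm \<psi> x \<le> 1 \<and> psi_sum_norm \<psi> (R x - y) < e" if "0 < e" for e
      using near[OF that] x(1) unfolding N_def by blast
  qed (use inj dense \<open>0 < M\<close> R_bound perturb Ny in \<open>simp_all only: N_def\<close>)
qed

end
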